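(* Let $G$ be a linear algebraic group over an algebraically closed field $\Bbbk$ and let $G^0$ denote the connected component of the identity. Then $$\delta(G)\le \delta(G/G^0)\,\delta(G^0).$$ In particular, $\delta(G)$ is finite if $\delta(G^0)$ is finite.
   Context: For a linear algebraic group $G$ over $\Bbbk$, a $G$-module is a finite-dimensional rational representation $V$ of $G$ over $\Bbbk$. $\Bbbk[V]\cong S(V^* )$ is the ring of polynomial functions on $V$, with $G$-action $(g\cdot f)(v)=f(g^{-1}v)$ and invariant ring $\Bbbk[V]^G$, graded by degree. $\Bbbk[V]^G_{\le d}$ is the set of invariants of degree at most $d$. For $S\subseteq \Bbbk[V]$, $S_+$ is the set of elements of $S$ with constant term zero. The nullcone $\mathcal{N}_{G,V}\subseteq V$ is the common zero set of $\Bbbk[V]^G_+$. A subset $S\subseteq\Bbbk[V]^G$ is a $\delta$-set if for every $v\in V^G\setminus\mathcal{N}_{G,V}$ there is $f\in S_+$ with $f(v)\neq 0$. Define $\delta(G,V)=\min\{d\ge 0 : \Bbbk[V]^G_{\le d}\text{ is a }\delta\text{-set}\}$ and $\delta(G)=\sup\{\delta(G,V): V\text{ a }G\text{-module}\}\in\mathbb{N}\cup\{\infty\}$ (equal to $\infty$ if unbounded). *)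

theory Defs
  imports
    "HOL-Analysis.Abstract_Topology_2"
    "HOL-Library.Extended_Nat"
    "HOL-Computational_Algebra.Polynomial"
    "HOL-Algebra.Coset"
    "Jordan_Normal_Form.Matrix"
begin

section \<open>Polynomial functions on affine space\<close>

definition exponents :: "nat \<Rightarrow> nat \<Rightarrow> (nat \<Rightarrow> nat) set" where
  "exponents n d = {\<alpha>. (\<forall>i\<ge>n. \<alpha> i = 0) \<and> (\<Sum>i<n. \<alpha> i) \<le> d}"

definition poly_function :: "nat \<Rightarrow> nat \<Rightarrow> ((nat \<Rightarrow> nat) \<Rightarrow> 'k::field) \<Rightarrow> 'k vec \<Rightarrow> 'k" where
  "poly_function n d c =
     (\<lambda>v\<in>carrier_vec n. \<Sum>\<alpha>\<in>exponents n d. c \<alpha> * (\<Prod>i<n. (v $ i) ^ \<alpha> i))"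

text \<open>
  The functions on the space of column vectors of length \<open>n\<close> given by polynomials of degree
  at most \<open>d\<close>. All functions on a carrier set \<open>X\<close> are taken to be extensional (undefined
  outside \<open>X\<close>), so that equality of functions is equality on \<open>X\<close>. Over an infinite field a
  polynomial function determines its polynomial, so the degree is unambiguous.
\<close>
definition poly_functions_upto :: "nat \<Rightarrow> nat \<Rightarrow> ('k::field vec \<Rightarrow> 'k) set" where
  "poly_functions_upto n d = range (poly_function n d)"

definition poly_functions :: "nat \<Rightarrow> ('k::field vec \<Rightarrow> 'k) set" where
  "poly_functions n = (\<Union>d. poly_functions_upto n d)"

lemma finite_exponents: "finite (exponents n d)"
proof (rule finite_subset)
  show "exponents n d \<subseteq> {\<alpha>. \<forall>i. (i \<in> {..<n} \<longrightarrow> \<alpha> i \<in> {..d}) \<and> (i \<notin> {..<n} \<longrightarrow> \<alpha> i = 0)}"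
  proof
    fix \<alpha> assume a: "\<alpha> \<in> exponents n d"
    have "\<alpha> i \<le> d" if "i < n" for i
    proof -
      have "\<alpha> i \<le> (\<Sum>i<n. \<alpha> i)"
        using that by (intro member_le_sum) auto
      then show ?thesis using a by (auto simp: exponents_def)
    qed
    then show "\<alpha> \<in> {\<alpha>. \<forall>i. (i \<in> {..<n} \<longrightarrow> \<alpha> i \<in> {..d}) \<and> (i \<notin> {..<n} \<longrightarrow> \<alpha> i = 0)}"
      using a by (auto simp: exponents_def)
  qed
  show "finite {\<alpha>. \<forall>i. (i \<in> {..<n} \<longrightarrow> \<alpha> i \<in> {..d}) \<and> (i \<notin> {..<n} \<longrightarrow> \<alpha> i = (0::nat))}"
    by (rule finite_set_of_finite_funs) auto
qed

definition constant_term :: "nat \<Rightarrow> ('k::field vec \<Rightarrow> 'k) \<Rightarrow> 'k" where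
  "constant_term n f = f (0\<^sub>v n)"

lemma constant_term_poly_function: "constant_term n (poly_function n d c) = c (\<lambda>_. 0)"
proof -
  have prod0: "(\<Prod>i<n. ((0\<^sub>v n :: 'a vec) $ i) ^ \<alpha> i) = 0"
    if "\<alpha> \<in> exponents n d - {\<lambda>_. 0}" for \<alpha>
  proof -
    from that have "\<alpha> \<noteq> (\<lambda>_. 0)" by simp
    then obtain i where i: "\<alpha> i \<noteq> 0" by blast
    have "\<forall>i\<ge>n. \<alpha> i = 0" using that by (simp add: exponents_def)
    with i have "i < n" by (meson not_le)
    with i show ?thesis by (intro prod_zero bexI[of _ i]) auto
  qed
  have "(\<Sum>\<alpha>\<in>exponents n d. c \<alpha> * (\<Prod>i<n. ((0\<^sub>v n :: 'a vec) $ i) ^ \<alpha> i)) =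
        (\<Sum>\<alpha>\<in>{\<lambda>_. 0}. c \<alpha> * (\<Prod>i<n. ((0\<^sub>v n :: 'a vec) $ i) ^ \<alpha> i))"
    by (rule sum.mono_neutral_right)
       (use finite_exponents prod0 in \<open>auto simp: exponents_def\<close>)
  then show ?thesis by (simp add: constant_term_def poly_function_def)
qed


section \<open>Linear algebraic groups\<close>

text \<open>
  An affine variety over \<open>'k\<close> is a set \<open>X\<close> with a ring \<open>A\<close> of functions on it (its coordinate
  ring) such that some bijection of \<open>X\<close> with a Zariski closed subset of an affine space
  identifies \<open>A\<close> with the ring of restrictions of polynomial functions.
\<close>
definition affine_variety :: "'a set \<Rightarrow> ('a \<Rightarrow> 'k::field) set \<Rightarrow> bool" where
  "affine_variety X A \<longleftrightarrow>
     (\<exists>n \<phi> S. S \<subseteq> poly_functions n \<and>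
        bij_betw \<phi> X {v \<in> carrier_vec n. \<forall>p\<in>S. p v = 0} \<and>
        A = {\<lambda>x\<in>X. p (\<phi> x) | p. p \<in> poly_functions n})"

record ('a, 'k) algebraic_group = "'a monoid" +
  regular_functions :: "('a \<Rightarrow> 'k) set"

text \<open>
  The last two axioms say that inversion and multiplication are morphisms of varieties; the
  coordinate ring of the product of \<open>G\<close> with itself consists of the finite sums of functions
  \<open>(x, y) \<mapsto> g x * h y\<close> with \<open>g\<close>, \<open>h\<close> regular on \<open>G\<close>.
\<close>
locale linear_algebraic_group = group G
  for G :: "('a, 'k::alg_closed_field) algebraic_group" (structure) +
  assumes variety: "affine_variety (carrier G) (regular_functions G)"
    and regular_inv:
      "f \<in> regular_functions G \<Longrightarrow> (\<lambda>x\<in>carrier G. f (inv x)) \<in> regular_functions G"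
    and regular_mult:
      "f \<in> regular_functions G \<Longrightarrow>
         \<exists>(m::nat) g h. (\<forall>i<m. g i \<in> regular_functions G \<and> h i \<in> regular_functions G) \<and>
           (\<forall>x\<in>carrier G. \<forall>y\<in>carrier G. f (x \<otimes> y) = (\<Sum>i<m. g i x * h i y))"

definition zero_locus ::
  "('a, 'k::field) algebraic_group \<Rightarrow> ('a \<Rightarrow> 'k) set \<Rightarrow> 'a set" where
  "zero_locus G S = {x \<in> carrier G. \<forall>f\<in>S. f x = 0}"

definition zariski_topology :: "('a, 'k::field) algebraic_group \<Rightarrow> 'a topology" where
  "zariski_topology G =
     topology_generated_by {carrier G - zero_locus G S | S. S \<subseteq> regular_functions G}"

text \<open>
  The connected component of the identity, as a set and as an algebraic group. The coordinate
  ring of a closed subgroup consists of the restrictions of the regular functions.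
\<close>
definition identity_component_set :: "('a, 'k::field) algebraic_group \<Rightarrow> 'a set" where
  "identity_component_set G = connected_component_of_set (zariski_topology G) \<one>\<^bsub>G\<^esub>"

definition closed_subgroup ::
  "('a, 'k::field) algebraic_group \<Rightarrow> 'a set \<Rightarrow> ('a, 'k) algebraic_group" where
  "closed_subgroup G H =
     G\<lparr>carrier := H, regular_functions := (\<lambda>f. restrict f H) ` regular_functions G\<rparr>"

definition identity_component ::
  "('a, 'k::field) algebraic_group \<Rightarrow> ('a, 'k) algebraic_group" where
  "identity_component G = closed_subgroup G (identity_component_set G)"

text \<open>
  The quotient by a closed normal subgroup \<open>N\<close>: a function on \<open>G Mod N\<close> is regular iff its
  pullback along the projection is regular on \<open>G\<close>.
\<close>
definition quotient_group ::
  "('a, 'k::field) algebraic_group \<Rightarrow> 'a set \<Rightarrow> ('a set, 'k) algebraic_group" where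
  "quotient_group G N =
     monoid.extend (G Mod N)
       (algebraic_group.fields
          {f \<in> extensional (carrier (G Mod N)).
             (\<lambda>x\<in>carrier G. f (N #>\<^bsub>G\<^esub> x)) \<in> regular_functions G})"

lemma quotient_group_simps [simp]:
  "carrier (quotient_group G N) = carrier (G Mod N)"
  "mult (quotient_group G N) = mult (G Mod N)"
  "one (quotient_group G N) = one (G Mod N)"
  "regular_functions (quotient_group G N) =
     {f \<in> extensional (carrier (G Mod N)).
        (\<lambda>x\<in>carrier G. f (N #>\<^bsub>G\<^esub> x)) \<in> regular_functions G}"
  by (simp_all add: quotient_group_def monoid.defs algebraic_group.defs)


section \<open>Modules and invariants\<close>

text \<open>
  A \<open>G\<close>-module with underlying space \<open>'k\<^sup>n\<close>, given as a matrix representation with regular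
  matrix coefficients. Up to isomorphism every finite-dimensional rational representation is
  of this form.
\<close>
definition rational_rep ::
  "('a, 'k::field) algebraic_group \<Rightarrow> nat \<Rightarrow> ('a \<Rightarrow> 'k mat) \<Rightarrow> bool" where
  "rational_rep G n \<rho> \<longleftrightarrow>
     \<rho> \<in> carrier G \<rightarrow> carrier_mat n n \<and>
     \<rho> \<one>\<^bsub>G\<^esub> = 1\<^sub>m n \<and>
     (\<forall>g\<in>carrier G. \<forall>h\<in>carrier G. \<rho> (g \<otimes>\<^bsub>G\<^esub> h) = \<rho> g * \<rho> h) \<and>
     (\<forall>i<n. \<forall>j<n. (\<lambda>g\<in>carrier G. \<rho> g $$ (i, j)) \<in> regular_functions G)"

definition act_on_function ::
  "('a, 'k::field) algebraic_group \<Rightarrow> nat \<Rightarrow> ('a \<Rightarrow> 'k mat) \<Rightarrow> 'a \<Rightarrow> ('k vec \<Rightarrow> 'k) \<Rightarrow> 'k vec \<Rightarrow> 'k"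
  where "act_on_function G n \<rho> g f = (\<lambda>v\<in>carrier_vec n. f (\<rho> (inv\<^bsub>G\<^esub> g) *\<^sub>v v))"

definition invariants ::
  "('a, 'k::field) algebraic_group \<Rightarrow> nat \<Rightarrow> ('a \<Rightarrow> 'k mat) \<Rightarrow> ('k vec \<Rightarrow> 'k) set" where
  "invariants G n \<rho> =
     {f \<in> poly_functions n. \<forall>g\<in>carrier G. act_on_function G n \<rho> g f = f}"

definition invariants_upto ::
  "('a, 'k::field) algebraic_group \<Rightarrow> nat \<Rightarrow> ('a \<Rightarrow> 'k mat) \<Rightarrow> nat \<Rightarrow> ('k vec \<Rightarrow> 'k) set" where
  "invariants_upto G n \<rho> d = invariants G n \<rho> \<inter> poly_functions_upto n d"

definition fixed_points ::
  "('a, 'k::field) algebraic_group \<Rightarrow> nat \<Rightarrow> ('a \<Rightarrow> 'k mat) \<Rightarrow> 'k vec set" where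
  "fixed_points G n \<rho> = {v \<in> carrier_vec n. \<forall>g\<in>carrier G. \<rho> g *\<^sub>v v = v}"

definition plus_part :: "nat \<Rightarrow> ('k::field vec \<Rightarrow> 'k) set \<Rightarrow> ('k vec \<Rightarrow> 'k) set" where
  "plus_part n S = {f \<in> S. constant_term n f = 0}"

definition nullcone ::
  "('a, 'k::field) algebraic_group \<Rightarrow> nat \<Rightarrow> ('a \<Rightarrow> 'k mat) \<Rightarrow> 'k vec set" where
  "nullcone G n \<rho> = {v \<in> carrier_vec n. \<forall>f\<in>plus_part n (invariants G n \<rho>). f v = 0}"


section \<open>The delta number\<close>

definition delta_set ::
  "('a, 'k::field) algebraic_group \<Rightarrow> nat \<Rightarrow> ('a \<Rightarrow> 'k mat) \<Rightarrow> ('k vec \<Rightarrow> 'k) set \<Rightarrow> bool" where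
  "delta_set G n \<rho> S \<longleftrightarrow>
     S \<subseteq> invariants G n \<rho> \<and>
     (\<forall>v \<in> fixed_points G n \<rho> - nullcone G n \<rho>. \<exists>f\<in>plus_part n S. f v \<noteq> 0)"

text \<open>
  The infimum in \<open>enat\<close> of a nonempty set of natural numbers is its minimum.
\<close>
definition delta_module ::
  "('a, 'k::field) algebraic_group \<Rightarrow> nat \<Rightarrow> ('a \<Rightarrow> 'k mat) \<Rightarrow> enat" where
  "delta_module G n \<rho> = Inf {enat d | d. delta_set G n \<rho> (invariants_upto G n \<rho> d)}"

definition delta :: "('a, 'k::field) algebraic_group \<Rightarrow> enat" where
  "delta G = Sup {delta_module G n \<rho> | n \<rho>. rational_rep G n \<rho>}"

end

theory Submission
  imports Defs "Jordan_Normal_Form.Determinant" "HOL-Library.Function_Algebras"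
begin

text \<open>
  Write \<open>N\<close> for the identity component and \<open>W\<close> for the space of \<open>N\<close>-invariants of degree at most
  \<open>\<delta>(N)\<close> without constant term. Evaluation on \<open>W\<close> is a \<open>G\<close>-equivariant polynomial map from \<open>V\<close> to
  the dual of \<open>W\<close>, which is a module for \<open>Q = G/N\<close>. A fixed point \<open>v\<close> outside the nullcone is sent to
  a nonzero fixed point of \<open>Q\<close>; as \<open>Q\<close> is finite, that point is again outside the nullcone, and an
  invariant of \<open>Q\<close> of degree at most \<open>\<delta>(Q)\<close> that separates it from zero pulls back to the required
  invariant of \<open>G\<close>. Finiteness of \<open>Q\<close>, and with it of \<open>\<delta>(Q)\<close>, rests on Hilbert's basis theorem: the
  Zariski topology is Noetherian, so \<open>G\<close> has finitely many components.
\<close>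

section \<open>Degrees of polynomial functions\<close>

lemma restrict_in_poly_functions_upto_iff:
  "restrict f (carrier_vec n) \<in> poly_functions_upto n d \<longleftrightarrow>
     (\<exists>c. \<forall>v\<in>carrier_vec n. f v = (\<Sum>\<alpha>\<in>exponents n d. c \<alpha> * (\<Prod>i<n. (v $ i) ^ \<alpha> i)))"
proof -
  have "restrict f (carrier_vec n) = poly_function n d c \<longleftrightarrow>
      (\<forall>v\<in>carrier_vec n. f v = (\<Sum>\<alpha>\<in>exponents n d. c \<alpha> * (\<Prod>i<n. (v $ i) ^ \<alpha> i)))" for c
    by (auto simp: poly_function_def fun_eq_iff restrict_def)
  then show ?thesis by (auto simp: poly_functions_upto_def)
qed

lemma restrict_poly_functions_upto [simp]:
  "f \<in> poly_functions_upto n d \<Longrightarrow> restrict f (carrier_vec n) = f"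
  by (auto simp: poly_functions_upto_def poly_function_def)

lemma poly_functions_upto_add:
  assumes "restrict f (carrier_vec n) \<in> poly_functions_upto n d"
    and "restrict g (carrier_vec n) \<in> poly_functions_upto n d"
  shows "(\<lambda>v\<in>carrier_vec n. f v + g v) \<in> poly_functions_upto n d"
proof -
  obtain a b where
    "\<forall>v\<in>carrier_vec n. f v = (\<Sum>\<alpha>\<in>exponents n d. a \<alpha> * (\<Prod>i<n. (v $ i) ^ \<alpha> i))"
    "\<forall>v\<in>carrier_vec n. g v = (\<Sum>\<alpha>\<in>exponents n d. b \<alpha> * (\<Prod>i<n. (v $ i) ^ \<alpha> i))"
    using assms unfolding restrict_in_poly_functions_upto_iff by blast
  then show ?thesis unfolding restrict_in_poly_functions_upto_iff
    by (intro exI[of _ "\<lambda>\<alpha>. a \<alpha> + b \<alpha>"]) (auto simp: sum.distrib algebra_simps)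
qed

lemma poly_functions_upto_smult:
  assumes "restrict f (carrier_vec n) \<in> poly_functions_upto n d"
  shows "(\<lambda>v\<in>carrier_vec n. a * f v) \<in> poly_functions_upto n d"
proof -
  obtain c where "\<forall>v\<in>carrier_vec n. f v = (\<Sum>\<alpha>\<in>exponents n d. c \<alpha> * (\<Prod>i<n. (v $ i) ^ \<alpha> i))"
    using assms unfolding restrict_in_poly_functions_upto_iff by blast
  then show ?thesis unfolding restrict_in_poly_functions_upto_iff
    by (intro exI[of _ "\<lambda>\<alpha>. a * c \<alpha>"]) (auto simp: sum_distrib_left algebra_simps)
qed

lemma poly_functions_upto_sum:
  fixes f :: "'i \<Rightarrow> 'k::field vec \<Rightarrow> 'k"
  assumes "\<And>i. i \<in> I \<Longrightarrow> restrict (f i) (carrier_vec n) \<in> poly_functions_upto n d"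
  shows "(\<lambda>v\<in>carrier_vec n. \<Sum>i\<in>I. f i v) \<in> poly_functions_upto n d"
proof -
  have zero: "(\<lambda>v\<in>carrier_vec n. 0::'k) \<in> poly_functions_upto n d"
    unfolding restrict_in_poly_functions_upto_iff by (intro exI[of _ "\<lambda>_. 0"]) auto
  show ?thesis using assms
  proof (induction I rule: infinite_finite_induct)
    case (infinite I)
    then show ?case by (simp only: sum.infinite zero not_False_eq_True)
  next
    case empty
    then show ?case by (simp only: sum.empty zero)
  next
    case (insert i I)
    have "(\<lambda>v\<in>carrier_vec n. f i v + (\<Sum>i\<in>I. f i v)) \<in> poly_functions_upto n d"
      by (intro poly_functions_upto_add insert.IH insert.prems insertI1 insertI2)
    then show ?case by (simp only: sum.insert[OF insert.hyps])
  qed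
qed

lemma poly_functions_upto_monom:
  assumes "\<alpha> \<in> exponents n d"
  shows "(\<lambda>v\<in>carrier_vec n. \<Prod>i<n. (v $ i) ^ \<alpha> i) \<in> poly_functions_upto n d"
  unfolding restrict_in_poly_functions_upto_iff
proof (intro exI[of _ "\<lambda>\<beta>. if \<beta> = \<alpha> then 1 else 0"] ballI)
  fix v :: "'a vec" assume v: "v \<in> carrier_vec n"
  have "(\<Sum>\<beta>\<in>exponents n d. (if \<beta> = \<alpha> then 1 else 0) * (\<Prod>i<n. (v $ i) ^ \<beta> i))
      = (\<Sum>\<beta>\<in>exponents n d. if \<beta> = \<alpha> then (\<Prod>i<n. (v $ i) ^ \<beta> i) else 0)"
    by (intro sum.cong) auto
  then show "(\<Prod>i<n. (v $ i) ^ \<alpha> i) =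
      (\<Sum>\<beta>\<in>exponents n d. (if \<beta> = \<alpha> then 1 else 0) * (\<Prod>i<n. (v $ i) ^ \<beta> i))"
    using assms finite_exponents[of n d] by simp
qed

lemma poly_functions_upto_mult:
  assumes "restrict f (carrier_vec n) \<in> poly_functions_upto n d"
    and "restrict g (carrier_vec n) \<in> poly_functions_upto n e"
  shows "(\<lambda>v\<in>carrier_vec n. f v * g v) \<in> poly_functions_upto n (d + e)"
proof -
  obtain a b where ab:
    "\<forall>v\<in>carrier_vec n. f v = (\<Sum>\<alpha>\<in>exponents n d. a \<alpha> * (\<Prod>i<n. (v $ i) ^ \<alpha> i))"
    "\<forall>v\<in>carrier_vec n. g v = (\<Sum>\<alpha>\<in>exponents n e. b \<alpha> * (\<Prod>i<n. (v $ i) ^ \<alpha> i))"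
    using assms unfolding restrict_in_poly_functions_upto_iff by blast
  have exps: "(\<lambda>i. \<alpha> i + \<beta> i) \<in> exponents n (d + e)"
    if "\<alpha> \<in> exponents n d" "\<beta> \<in> exponents n e" for \<alpha> \<beta>
    using that by (auto simp: exponents_def sum.distrib)
  have "(\<lambda>v\<in>carrier_vec n. \<Sum>\<alpha>\<in>exponents n d. \<Sum>\<beta>\<in>exponents n e.
      (a \<alpha> * b \<beta>) * (\<Prod>i<n. (v $ i) ^ (\<alpha> i + \<beta> i))) \<in> poly_functions_upto n (d + e)"
    by (intro poly_functions_upto_sum poly_functions_upto_smult poly_functions_upto_monom exps)
  moreover have "(\<lambda>v\<in>carrier_vec n. f v * g v) =
    (\<lambda>v\<in>carrier_vec n. \<Sum>\<alpha>\<in>exponents n d. \<Sum>\<beta>\<in>exponents n e.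
      (a \<alpha> * b \<beta>) * (\<Prod>i<n. (v $ i) ^ (\<alpha> i + \<beta> i)))"
    by (intro restrict_ext) (simp add: ab sum_product power_add prod.distrib mult_ac)
  ultimately show ?thesis by simp
qed

lemma poly_functions_upto_mono:
  assumes "d \<le> e" "f \<in> poly_functions_upto n d"
  shows "f \<in> poly_functions_upto n e"
proof -
  obtain c where f: "f = poly_function n d c" using assms(2) by (auto simp: poly_functions_upto_def)
  have sub: "exponents n d \<subseteq> exponents n e" using assms(1) by (auto simp: exponents_def)
  have "(\<Sum>\<alpha>\<in>exponents n d. c \<alpha> * (\<Prod>i<n. (v $ i) ^ \<alpha> i)) =
      (\<Sum>\<alpha>\<in>exponents n e. (if \<alpha> \<in> exponents n d then c \<alpha> else 0) * (\<Prod>i<n. (v $ i) ^ \<alpha> i))" for v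
    using sub by (intro sum.mono_neutral_cong_left finite_exponents) auto
  then have "f = poly_function n e (\<lambda>\<alpha>. if \<alpha> \<in> exponents n d then c \<alpha> else 0)"
    by (simp add: f poly_function_def)
  then show ?thesis by (auto simp: poly_functions_upto_def)
qed

lemma poly_functions_upto_const: "(\<lambda>v\<in>carrier_vec n. a) \<in> poly_functions_upto n d"
proof -
  have "(\<lambda>v\<in>carrier_vec n. a * (\<Prod>i<n. (v $ i) ^ (\<lambda>_. 0) i)) \<in> poly_functions_upto n d"
    by (intro poly_functions_upto_smult poly_functions_upto_monom) (auto simp: exponents_def)
  then show ?thesis by simp
qed

lemma poly_functions_upto_coord:
  fixes n :: nat
  assumes "i < n"
  shows "(\<lambda>v\<in>carrier_vec n. v $ i :: 'k::field) \<in> poly_functions_upto n 1"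
proof -
  have "(\<Prod>j<n. (v $ j) ^ (if j = i then 1 else 0)) = v $ i" for v :: "'k vec"
  proof -
    have "(\<Prod>j<n. (v $ j) ^ (if j = i then 1 else 0)) = (\<Prod>j<n. if j = i then v $ j else 1)"
      by (intro prod.cong) auto
    then show ?thesis using assms by simp
  qed
  moreover have "(\<lambda>v\<in>carrier_vec n. \<Prod>j<n. (v $ j :: 'k) ^ (if j = i then 1 else 0))
      \<in> poly_functions_upto n 1"
    using assms by (intro poly_functions_upto_monom) (auto simp: exponents_def)
  ultimately show ?thesis by (simp only:)
qed

lemma poly_functions_upto_prod:
  assumes "finite I" "\<And>i. i \<in> I \<Longrightarrow> restrict (f i) (carrier_vec n) \<in> poly_functions_upto n (d i)"
  shows "(\<lambda>v\<in>carrier_vec n. \<Prod>i\<in>I. f i v) \<in> poly_functions_upto n (\<Sum>i\<in>I. d i)"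
  using assms
proof (induction I rule: finite_induct)
  case empty
  then show ?case by (simp only: prod.empty sum.empty poly_functions_upto_const)
next
  case (insert i I)
  have "(\<lambda>v\<in>carrier_vec n. f i v * (\<Prod>i\<in>I. f i v)) \<in> poly_functions_upto n (d i + (\<Sum>i\<in>I. d i))"
    by (intro poly_functions_upto_mult insert.IH insert.prems insertI1 insertI2)
  then show ?case by (simp only: prod.insert[OF insert.hyps] sum.insert[OF insert.hyps])
qed

lemma poly_functions_upto_power:
  assumes "restrict f (carrier_vec n) \<in> poly_functions_upto n d"
  shows "(\<lambda>v\<in>carrier_vec n. f v ^ k) \<in> poly_functions_upto n (k * d)"
  using poly_functions_upto_prod[of "{..<k}" "\<lambda>_. f" n "\<lambda>_. d"] assms by simp

lemma poly_functions_upto_compose: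
  fixes h :: "nat \<Rightarrow> 'k::field vec \<Rightarrow> 'k"
  assumes p: "p \<in> poly_functions_upto m e"
    and h: "\<And>i. i < m \<Longrightarrow> restrict (h i) (carrier_vec n) \<in> poly_functions_upto n d"
  shows "(\<lambda>v\<in>carrier_vec n. p (vec m (\<lambda>i. h i v))) \<in> poly_functions_upto n (e * d)"
proof -
  obtain c where c: "p = poly_function m e c" using p by (auto simp: poly_functions_upto_def)
  have "(\<lambda>v\<in>carrier_vec n. \<Sum>\<alpha>\<in>exponents m e. c \<alpha> * (\<Prod>i<m. (h i v) ^ \<alpha> i))
     \<in> poly_functions_upto n (e * d)"
  proof (intro poly_functions_upto_sum poly_functions_upto_smult)
    fix \<alpha> assume \<alpha>: "\<alpha> \<in> exponents m e"
    have "(\<lambda>v\<in>carrier_vec n. \<Prod>i<m. (h i v) ^ \<alpha> i) \<in> poly_functions_upto n (\<Sum>i<m. \<alpha> i * d)"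
      by (intro poly_functions_upto_prod poly_functions_upto_power h) auto
    moreover have "(\<Sum>i<m. \<alpha> i * d) \<le> e * d"
      using \<alpha> by (auto simp: exponents_def sum_distrib_right[symmetric])
    ultimately show "(\<lambda>v\<in>carrier_vec n. \<Prod>i<m. (h i v) ^ \<alpha> i) \<in> poly_functions_upto n (e * d)"
      using poly_functions_upto_mono by blast
  qed
  moreover have "(\<lambda>v\<in>carrier_vec n. \<Sum>\<alpha>\<in>exponents m e. c \<alpha> * (\<Prod>i<m. (h i v) ^ \<alpha> i))
     = (\<lambda>v\<in>carrier_vec n. p (vec m (\<lambda>i. h i v)))"
    unfolding c by (intro restrict_ext) (auto simp: poly_function_def)
  ultimately show ?thesis by simp
qed

lemma mult_mat_vec_eq:
  assumes "A \<in> carrier_mat m n" "v \<in> carrier_vec n"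
  shows "A *\<^sub>v v = vec m (\<lambda>i. \<Sum>j<n. A $$ (i, j) * v $ j)"
  using assms by (intro eq_vecI) (auto simp: scalar_prod_def atLeast0LessThan intro!: sum.cong)

lemma poly_functions_upto_mult_mat:
  assumes f: "f \<in> poly_functions_upto m d" and A: "A \<in> carrier_mat m n"
  shows "(\<lambda>v\<in>carrier_vec n. f (A *\<^sub>v v)) \<in> poly_functions_upto n d"
proof -
  have "(\<lambda>v\<in>carrier_vec n. f (vec m (\<lambda>i. \<Sum>j<n. A $$ (i, j) * v $ j)))
    \<in> poly_functions_upto n (d * 1)"
    by (intro poly_functions_upto_compose[OF f] poly_functions_upto_sum poly_functions_upto_smult
        poly_functions_upto_coord) auto
  moreover have "(\<lambda>v\<in>carrier_vec n. f (A *\<^sub>v v)) =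
      (\<lambda>v\<in>carrier_vec n. f (vec m (\<lambda>i. \<Sum>j<n. A $$ (i, j) * v $ j)))"
    by (intro restrict_ext) (simp add: mult_mat_vec_eq[OF A])
  ultimately show ?thesis by simp
qed

section \<open>Interpolation\<close>

lemma dual_system_bound:
  fixes c :: "nat \<Rightarrow> nat \<Rightarrow> 'k::field"
  assumes dual: "\<And>i j. i < m \<Longrightarrow> j < m \<Longrightarrow> (\<Sum>l<M. c i l * b l j) = (if i = j then 1 else 0)"
  shows "m \<le> M"
proof (rule ccontr)
  assume "\<not> m \<le> M"
  then have less: "M < m" by simp
  define A where "A = mat m m (\<lambda>(i, l). if l < M then c i l else 0)"
  define B where "B = mat m m (\<lambda>(l, j). if l < M then b l j else 0)"
  have "A * B = 1\<^sub>m m"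
  proof (rule eq_matI)
    fix i j assume ij: "i < dim_row (1\<^sub>m m :: 'k mat)" "j < dim_col (1\<^sub>m m :: 'k mat)"
    have "(A * B) $$ (i, j) = (\<Sum>l<m. if l < M then c i l * b l j else 0)"
      using ij by (auto simp: A_def B_def scalar_prod_def atLeast0LessThan intro!: sum.cong)
    also have "\<dots> = (\<Sum>l<M. c i l * b l j)"
      using less by (intro sum.mono_neutral_cong_right) auto
    finally show "(A * B) $$ (i, j) = 1\<^sub>m m $$ (i, j)" using ij dual by auto
  qed (auto simp: A_def B_def)
  then have "B * A = 1\<^sub>m m"
    by (rule mat_mult_left_right_inverse[rotated 2]) (auto simp: A_def B_def)
  then have "(B * A) $$ (M, M) = 1" using less by simp
  moreover have "(B * A) $$ (M, M) = 0"
    using less by (simp add: A_def B_def scalar_prod_def)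
  ultimately show False by simp
qed

text \<open>
  The points \<open>u i\<close> and the functions \<open>h i\<close> are dual bases; a maximal dual system exists since its
  size is bounded by \<open>M\<close>, and it is a basis because otherwise it could be enlarged.
\<close>

lemma interpolation:
  fixes W :: "('x \<Rightarrow> 'k::field) set"
  assumes lin: "\<And>(m::nat) a h. (\<And>i. i < m \<Longrightarrow> h i \<in> W) \<Longrightarrow> \<exists>k\<in>W. \<forall>x\<in>X. k x = (\<Sum>i<m. a i * h i x)"
    and span: "\<And>h. h \<in> W \<Longrightarrow> \<exists>c. \<forall>x\<in>X. h x = (\<Sum>l<M. c l * e (l::nat) x)"
  obtains m u h where "\<forall>i<m. u i \<in> X" "\<forall>i<m. h i \<in> W"
    "\<forall>i<m. \<forall>j<m. h i (u j) = (if i = j then 1 else 0)"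
    "\<forall>f\<in>W. \<forall>x\<in>X. f x = (\<Sum>i<(m::nat). f (u i) * h i x)"
proof -
  define P where "P m u h \<longleftrightarrow> (\<forall>i<m. u i \<in> X) \<and> (\<forall>i<m. h i \<in> W) \<and>
    (\<forall>i<m. \<forall>j<m. h i (u j) = (if i = j then 1 else 0))" for m :: nat and u :: "nat \<Rightarrow> 'x" and h
  have bound: "m \<le> M" if "P m u h" for m u h
  proof -
    have "\<forall>i. \<exists>c. i < m \<longrightarrow> (\<forall>x\<in>X. h i x = (\<Sum>l<M. c l * e l x))"
      using that span unfolding P_def by meson
    then obtain c where c: "\<And>i x. i < m \<Longrightarrow> x \<in> X \<Longrightarrow> h i x = (\<Sum>l<M. c i l * e l x)"
      by metis
    show ?thesis
      by (rule dual_system_bound[where c = c and b = "\<lambda>l j. e l (u j)"])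
         (use that in \<open>auto simp: P_def c[symmetric]\<close>)
  qed
  have "\<exists>m. (\<exists>u h. P m u h) \<and> (\<forall>m'. (\<exists>u h. P m' u h) \<longrightarrow> m' \<le> m)"
  proof (rule ccontr)
    assume neg: "\<nexists>m. (\<exists>u h. P m u h) \<and> (\<forall>m'. (\<exists>u h. P m' u h) \<longrightarrow> m' \<le> m)"
    have "\<exists>m\<ge>k. \<exists>u h. P m u h" for k
    proof (induction k)
      case 0
      have "P 0 undefined undefined" by (simp add: P_def)
      then show ?case by blast
    next
      case (Suc k)
      then show ?case using neg by (meson Suc_leI le_trans not_le)
    qed
    from this[of "Suc M"] show False using bound by (meson Suc_n_not_le_n le_trans)
  qed
  then obtain m u h where P: "P m u h" and max: "\<And>m' u' h'. P m' u' h' \<Longrightarrow> m' \<le> m" by blast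
  have repr: "f x = (\<Sum>i<m. f (u i) * h i x)" if f: "f \<in> W" and x: "x \<in> X" for f x
  proof (rule ccontr)
    assume neq: "f x \<noteq> (\<Sum>i<m. f (u i) * h i x)"
    define s where "s = f x - (\<Sum>i<m. f (u i) * h i x)"
    have s0: "s \<noteq> 0" using neq by (simp add: s_def)
    obtain k where k: "k \<in> W" "\<And>y. y \<in> X \<Longrightarrow> k y = (f y - (\<Sum>i<m. f (u i) * h i y)) / s"
    proof -
      have "\<exists>k\<in>W. \<forall>y\<in>X. k y = (\<Sum>i<Suc m. (if i < m then - f (u i) / s else 1 / s) * (if i < m then h i else f) y)"
        by (rule lin) (use f P in \<open>auto simp: P_def\<close>)
      moreover have "(\<Sum>i<Suc m. (if i < m then - f (u i) / s else 1 / s) * (if i < m then h i else f) y)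
        = (f y - (\<Sum>i<m. f (u i) * h i y)) / s" for y
        by (simp add: diff_divide_distrib sum_divide_distrib sum_negf)
      ultimately show ?thesis using that by auto
    qed
    have ku: "k (u j) = 0" if j: "j < m" for j
    proof -
      have "(\<Sum>i<m. f (u i) * h i (u j)) = (\<Sum>i<m. if i = j then f (u i) else 0)"
        using P j by (intro sum.cong) (auto simp: P_def)
      then show ?thesis using k P j by (simp add: P_def)
    qed
    have kx: "k x = 1" using k x s0 by (simp add: s_def)
    have "\<forall>i. \<exists>g. i < m \<longrightarrow> g \<in> W \<and> (\<forall>y\<in>X. g y = h i y - h i x * k y)"
    proof (intro allI)
      fix i
      have "\<exists>g\<in>W. \<forall>y\<in>X. g y = (\<Sum>l<(2::nat). (if l = 0 then 1 else - h i x) * (if l = 0 then h i else k) y)"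
        if "i < m" by (rule lin) (use P k that in \<open>auto simp: P_def\<close>)
      then show "\<exists>g. i < m \<longrightarrow> g \<in> W \<and> (\<forall>y\<in>X. g y = h i y - h i x * k y)"
        by (auto simp: numeral_2_eq_2)
    qed
    then obtain g where g: "\<And>i. i < m \<Longrightarrow> g i \<in> W"
      "\<And>i y. i < m \<Longrightarrow> y \<in> X \<Longrightarrow> g i y = h i y - h i x * k y" by metis
    have "P (Suc m) (u(m := x)) (g(m := k))"
      using P g k ku kx x by (auto simp: P_def less_Suc_eq)
    from max[OF this] show False by simp
  qed
  show ?thesis by (rule that[of m u h]) (use P repr in \<open>auto simp: P_def\<close>)
qed

section \<open>Hilbert's basis theorem\<close>

definition unital_subring :: "'r::comm_ring_1 set \<Rightarrow> bool" where
  "unital_subring R \<longleftrightarrow> 0 \<in> R \<and> 1 \<in> R \<and> (\<forall>a\<in>R. - a \<in> R) \<and>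
     (\<forall>a\<in>R. \<forall>b\<in>R. a + b \<in> R \<and> a * b \<in> R)"

definition subring_ideal :: "'r::comm_ring_1 set \<Rightarrow> 'r set \<Rightarrow> bool" where
  "subring_ideal R I \<longleftrightarrow> I \<subseteq> R \<and> 0 \<in> I \<and> (\<forall>a\<in>I. \<forall>b\<in>I. a + b \<in> I) \<and> (\<forall>r\<in>R. \<forall>a\<in>I. r * a \<in> I)"

definition noetherian_subring :: "'r::comm_ring_1 set \<Rightarrow> bool" where
  "noetherian_subring R \<longleftrightarrow> unital_subring R \<and>
     (\<forall>I. incseq I \<and> (\<forall>k. subring_ideal R (I k)) \<longrightarrow> (\<exists>s. \<forall>k\<ge>s. I k = I s))"

text \<open>
  Elements of \<open>adjoin R f\<close> may have several representing polynomials; the ideals of leading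
  coefficients range over all of them, so no algebraic independence of \<open>f\<close> is needed.
\<close>

definition adjoin :: "'r::comm_ring_1 set \<Rightarrow> 'r \<Rightarrow> 'r set" where
  "adjoin R f = {poly p f | p. \<forall>i. coeff p i \<in> R}"

definition leading_coeffs :: "'r::comm_ring_1 set \<Rightarrow> 'r \<Rightarrow> 'r set \<Rightarrow> nat \<Rightarrow> 'r set" where
  "leading_coeffs R f I d =
     {coeff p d | p. (\<forall>i. coeff p i \<in> R) \<and> (\<forall>i>d. coeff p i = 0) \<and> poly p f \<in> I}"

lemma unital_subring_sum:
  assumes "unital_subring R" "\<And>i. i \<in> I \<Longrightarrow> f i \<in> R"
  shows "sum f I \<in> R"
  using assms(2)
  by (induction I rule: infinite_finite_induct) (use assms(1) in \<open>auto simp: unital_subring_def\<close>)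

lemma unital_subring_adjoin:
  assumes R: "unital_subring R"
  shows "unital_subring (adjoin R f)"
  unfolding unital_subring_def
proof (intro conjI ballI)
  show "0 \<in> adjoin R f" unfolding adjoin_def
    by (rule CollectI, rule exI[of _ 0]) (use R in \<open>auto simp: unital_subring_def\<close>)
  show "1 \<in> adjoin R f" unfolding adjoin_def
    by (rule CollectI, rule exI[of _ 1]) (use R in \<open>auto simp: unital_subring_def coeff_1\<close>)
  fix a assume "a \<in> adjoin R f"
  then obtain p where p: "a = poly p f" "\<And>i. coeff p i \<in> R" by (auto simp: adjoin_def)
  then show "- a \<in> adjoin R f" unfolding adjoin_def
    by (intro CollectI exI[of _ "- p"]) (use R in \<open>auto simp: unital_subring_def\<close>)
  fix b assume "b \<in> adjoin R f"
  then obtain q where q: "b = poly q f" "\<And>i. coeff q i \<in> R" by (auto simp: adjoin_def)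
  show "a + b \<in> adjoin R f" unfolding adjoin_def
    by (intro CollectI exI[of _ "p + q"]) (use R p q in \<open>auto simp: unital_subring_def\<close>)
  have "coeff (p * q) i \<in> R" for i
    unfolding coeff_mult
    by (intro unital_subring_sum[OF R]) (use R p q in \<open>auto simp: unital_subring_def\<close>)
  then show "a * b \<in> adjoin R f" unfolding adjoin_def
    by (intro CollectI exI[of _ "p * q"]) (use p q in auto)
qed

lemma subset_adjoin:
  assumes "unital_subring R"
  shows "R \<subseteq> adjoin R f"
proof
  fix a assume "a \<in> R"
  then show "a \<in> adjoin R f" unfolding adjoin_def
    by (intro CollectI exI[of _ "[:a:]"])
      (use assms in \<open>auto simp: unital_subring_def coeff_pCons split: nat.split\<close>)
qed

lemma in_adjoin:
  assumes "unital_subring R"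
  shows "f \<in> adjoin R f"
  unfolding adjoin_def
  by (intro CollectI exI[of _ "[:0, 1:]"])
    (use assms in \<open>auto simp: unital_subring_def coeff_pCons split: nat.split\<close>)

lemma leading_coeffs_ideal:
  assumes R: "unital_subring R" and I: "subring_ideal (adjoin R f) I"
  shows "subring_ideal R (leading_coeffs R f I d)"
  unfolding subring_ideal_def
proof (intro conjI ballI)
  show "leading_coeffs R f I d \<subseteq> R" by (auto simp: leading_coeffs_def)
  show "0 \<in> leading_coeffs R f I d" unfolding leading_coeffs_def
    by (intro CollectI exI[of _ 0]) (use R I in \<open>auto simp: unital_subring_def subring_ideal_def\<close>)
  fix a assume "a \<in> leading_coeffs R f I d"
  then obtain p where p: "a = coeff p d" "\<And>i. coeff p i \<in> R" "\<And>i. i > d \<Longrightarrow> coeff p i = 0" "poly p f \<in> I"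
    by (auto simp: leading_coeffs_def)
  {
    fix b assume "b \<in> leading_coeffs R f I d"
    then obtain q where "b = coeff q d" "\<And>i. coeff q i \<in> R" "\<And>i. i > d \<Longrightarrow> coeff q i = 0" "poly q f \<in> I"
      by (auto simp: leading_coeffs_def)
    with p show "a + b \<in> leading_coeffs R f I d" unfolding leading_coeffs_def
      by (intro CollectI exI[of _ "p + q"]) (use R I in \<open>auto simp: unital_subring_def subring_ideal_def\<close>)
  next
    fix r assume r: "r \<in> R"
    with p subset_adjoin[OF R, of f] show "r * a \<in> leading_coeffs R f I d" unfolding leading_coeffs_def
      by (intro CollectI exI[of _ "Polynomial.smult r p"]) (use R I in \<open>auto simp: unital_subring_def subring_ideal_def\<close>)
  }
qed

lemma leading_coeffs_mono:
  assumes R: "unital_subring R" and J: "subring_ideal (adjoin R f) J" and "I \<subseteq> J" "d \<le> e"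
  shows "leading_coeffs R f I d \<subseteq> leading_coeffs R f J e"
proof -
  have "leading_coeffs R f I d \<subseteq> leading_coeffs R f J d"
    using \<open>I \<subseteq> J\<close> by (auto simp: leading_coeffs_def)
  also have "\<dots> \<subseteq> leading_coeffs R f J e"
    using \<open>d \<le> e\<close>
  proof (induction e rule: dec_induct)
    case (step e)
    have "leading_coeffs R f J e \<subseteq> leading_coeffs R f J (Suc e)"
    proof
      fix a assume "a \<in> leading_coeffs R f J e"
      then obtain p where p: "a = coeff p e" "\<And>i. coeff p i \<in> R" "\<And>i. i > e \<Longrightarrow> coeff p i = 0" "poly p f \<in> J"
        by (auto simp: leading_coeffs_def)
      have "f * poly p f \<in> J" using J p in_adjoin[OF R, of f] by (auto simp: subring_ideal_def)
      then show "a \<in> leading_coeffs R f J (Suc e)" unfolding leading_coeffs_def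
        by (intro CollectI exI[of _ "pCons 0 p"])
          (use R p in \<open>auto simp: unital_subring_def coeff_pCons split: nat.splits\<close>)
    qed
    with step.IH show ?case by blast
  qed simp
  finally show ?thesis .
qed

lemma ideal_eq_of_leading_coeffs_eq:
  assumes R: "unital_subring R"
    and I: "subring_ideal (adjoin R f) I" and J: "subring_ideal (adjoin R f) J" and "I \<subseteq> J"
    and eq: "\<And>d. leading_coeffs R f I d = leading_coeffs R f J d"
  shows "I = J"
proof
  have "poly p f \<in> I" if "\<And>i. coeff p i \<in> R" "\<And>i. i \<ge> d \<Longrightarrow> coeff p i = 0" "poly p f \<in> J" for p d
    using that
  proof (induction d arbitrary: p)
    case 0
    then have "p = 0" by (simp add: poly_eq_iff)
    then show ?case using I by (simp add: subring_ideal_def)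
  next
    case (Suc d)
    have "coeff p d \<in> leading_coeffs R f J d"
      using Suc.prems by (auto simp: leading_coeffs_def)
    then obtain q where q: "coeff p d = coeff q d" "\<And>i. coeff q i \<in> R" "\<And>i. i > d \<Longrightarrow> coeff q i = 0"
      "poly q f \<in> I"
      unfolding eq[symmetric] by (auto simp: leading_coeffs_def)
    have "- 1 \<in> adjoin R f" using unital_subring_adjoin[OF R, of f] by (auto simp: unital_subring_def)
    then have "- 1 * poly q f \<in> J" using J \<open>I \<subseteq> J\<close> q(4) unfolding subring_ideal_def by blast
    then have "poly p f + - 1 * poly q f \<in> J" using J Suc.prems(3) unfolding subring_ideal_def by blast
    then have "poly (p - q) f \<in> J" by simp
    moreover have "coeff (p - q) i \<in> R" for i
      using R Suc.prems(1) q(2) unfolding unital_subring_def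
      by (metis coeff_diff diff_conv_add_uminus)
    moreover have "coeff (p - q) i = 0" if "i \<ge> d" for i
      using that Suc.prems(2) q by (cases "i = d") auto
    ultimately have "poly (p - q) f \<in> I" by (intro Suc.IH) auto
    then have "poly (p - q) f + poly q f \<in> I" using I q(4) unfolding subring_ideal_def by blast
    then show ?case by simp
  qed
  note * = this
  show "J \<subseteq> I"
  proof
    fix a assume a: "a \<in> J"
    then obtain p where "a = poly p f" "\<And>i. coeff p i \<in> R"
      using J by (auto simp: subring_ideal_def adjoin_def)
    then show "a \<in> I" using *[of p "Suc (degree p)"] a by (simp add: coeff_eq_0)
  qed
qed fact

theorem noetherian_subring_adjoin:
  assumes "noetherian_subring R"
  shows "noetherian_subring (adjoin R f)"
proof -
  have R: "unital_subring R" using assms by (simp add: noetherian_subring_def)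
  have acc: "\<exists>s. \<forall>k\<ge>s. K k = K s" if "incseq K" "\<And>k. subring_ideal R (K k)" for K
    using assms that by (auto simp: noetherian_subring_def)
  have "\<exists>s. \<forall>k\<ge>s. I k = I s" if inc: "incseq I" and I: "\<And>k. subring_ideal (adjoin R f) (I k)" for I
  proof -
    define L where "L d k = leading_coeffs R f (I k) d" for d k
    have L_ideal: "subring_ideal R (L d k)" for d k
      using leading_coeffs_ideal[OF R I] by (simp add: L_def)
    have L_mono: "L d k \<subseteq> L e l" if "d \<le> e" "k \<le> l" for d e k l
      using leading_coeffs_mono[OF R I _ that(1)] incseqD[OF inc that(2)] by (simp add: L_def)
    \<comment> \<open>\<open>L\<close> grows in both arguments: the diagonal settles every degree \<open>d \<ge> s\<close> at once, which
      leaves finitely many degrees.\<close>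
    obtain s where s: "\<And>k. k \<ge> s \<Longrightarrow> L k k = L s s"
      using acc[of "\<lambda>k. L k k"] L_ideal L_mono by (auto simp: incseq_def)
    have "\<forall>d. \<exists>t. \<forall>k\<ge>t. L d k = L d t"
      using acc[of "L d" for d] L_ideal L_mono by (auto simp: incseq_def)
    then obtain t where t: "\<And>d k. k \<ge> t d \<Longrightarrow> L d k = L d (t d)" by metis
    define u where "u = Max (insert s (t ` {..<s}))"
    have us: "u \<ge> s" and ut: "\<And>d. d < s \<Longrightarrow> u \<ge> t d" by (auto simp: u_def)
    have "I k = I u" if k: "k \<ge> u" for k
    proof (rule ideal_eq_of_leading_coeffs_eq[OF R I I, symmetric])
      show "I u \<subseteq> I k" using inc k by (simp add: incseqD)
      show "leading_coeffs R f (I u) d = leading_coeffs R f (I k) d" for d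
      proof (cases "d < s")
        case True
        then show ?thesis using t[of d u] t[of d k] ut[of d] k by (simp add: L_def)
      next
        case False
        have "L d l = L s s" if "l \<ge> s" for l
        proof
          show "L d l \<subseteq> L s s"
            using L_mono[of d "max d l" l "max d l"] s[of "max d l"] that by simp
          show "L s s \<subseteq> L d l" using L_mono False that by simp
        qed
        from this[of u] this[of k] show ?thesis using us k by (simp add: L_def)
      qed
    qed
    then show ?thesis by blast
  qed
  then show ?thesis using unital_subring_adjoin[OF R] by (simp add: noetherian_subring_def)
qed

lemma noetherian_subring_constants: "noetherian_subring (range (\<lambda>c::'k::field. \<lambda>_::'x. c))"
  unfolding noetherian_subring_def
proof (intro conjI allI impI)
  let ?K = "range (\<lambda>c::'k. \<lambda>_::'x. c)"
  show "unital_subring ?K"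
    by (auto simp: unital_subring_def fun_eq_iff image_iff)
  fix I :: "nat \<Rightarrow> ('x \<Rightarrow> 'k) set" assume I: "incseq I \<and> (\<forall>k. subring_ideal ?K (I k))"
  have full: "I k = ?K" if a: "a \<in> I k" "a \<noteq> 0" for a k
  proof
    show sub: "I k \<subseteq> ?K" using I by (auto simp: subring_ideal_def)
    obtain c where c: "a = (\<lambda>_. c)" using a sub by blast
    have "(\<lambda>_. e / c) * a \<in> I k" for e using I a by (auto simp: subring_ideal_def)
    moreover have "(\<lambda>_. e / c) * a = (\<lambda>_. e)" for e
      using a by (auto simp: c fun_eq_iff)
    ultimately show "?K \<subseteq> I k" by auto
  qed
  show "\<exists>s. \<forall>k\<ge>s. I k = I s"
  proof (cases "\<exists>s a. a \<in> I s \<and> a \<noteq> 0")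
    case True
    then obtain s a where a: "a \<in> I s" "a \<noteq> 0" by blast
    then have "a \<in> I k" if "k \<ge> s" for k using I that by (meson incseqD subsetD)
    then have "I k = I s" if "k \<ge> s" for k using full[OF a] full[of a k] a(2) that by blast
    then show ?thesis by blast
  next
    case False
    then have "I k = {0}" for k using I by (auto simp: subring_ideal_def)
    then show ?thesis by simp
  qed
qed

lemma noetherian_subring_generated:
  fixes y :: "nat \<Rightarrow> 'x \<Rightarrow> 'k::field"
  obtains R where "noetherian_subring R" "\<And>c. (\<lambda>_. c) \<in> R" "\<And>i. i < n \<Longrightarrow> y i \<in> R"
proof (induction n arbitrary: thesis)
  case 0
  show ?case by (rule 0[OF noetherian_subring_constants]) auto
next
  case (Suc n)
  obtain R where R: "noetherian_subring R" "\<And>c. (\<lambda>_. c) \<in> R" "\<And>i. i < n \<Longrightarrow> y i \<in> R"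
    using Suc.IH by blast
  have sub: "unital_subring R" using R by (simp add: noetherian_subring_def)
  show ?case
    by (rule Suc.prems[OF noetherian_subring_adjoin[OF R(1), of "y n"]])
      (use R subset_adjoin[OF sub] in_adjoin[OF sub] in \<open>auto simp: less_Suc_eq\<close>)
qed

lemma unital_subring_power: "unital_subring R \<Longrightarrow> a \<in> R \<Longrightarrow> a ^ k \<in> R"
  by (induction k) (auto simp: unital_subring_def)

lemma unital_subring_prod:
  assumes "unital_subring R" "\<And>i. i \<in> I \<Longrightarrow> f i \<in> R"
  shows "prod f I \<in> R"
  using assms(2)
  by (induction I rule: infinite_finite_induct) (use assms(1) in \<open>auto simp: unital_subring_def\<close>)

lemma sum_fun_eval: "(\<Sum>i\<in>I. f i) x = (\<Sum>i\<in>I. f i x)"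
  by (induction I rule: infinite_finite_induct) auto

lemma prod_fun_eval: "(\<Prod>i\<in>I. f i) x = (\<Prod>i\<in>I. f i x)"
  by (induction I rule: infinite_finite_induct) auto

lemma power_fun_eval: "(f ^ k) x = f x ^ k"
  by (induction k) auto

lemma poly_function_in_subring:
  assumes R: "unital_subring R" "\<And>c. (\<lambda>_. c) \<in> R" and y: "\<And>i. i < n \<Longrightarrow> y i \<in> R"
    and p: "p \<in> poly_functions n"
  obtains r where "r \<in> R" "\<And>x. p (vec n (\<lambda>i. y i x)) = r x"
proof -
  obtain d c where c: "p = poly_function n d c"
    using p by (auto simp: poly_functions_def poly_functions_upto_def)
  have mult: "a * b \<in> R" if "a \<in> R" "b \<in> R" for a b using R that by (auto simp: unital_subring_def)
  have "(\<Sum>\<alpha>\<in>exponents n d. (\<lambda>_. c \<alpha>) * (\<Prod>i<n. y i ^ \<alpha> i)) \<in> R"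
    by (intro unital_subring_sum R mult unital_subring_prod unital_subring_power y) auto
  moreover have "p (vec n (\<lambda>i. y i x)) = (\<Sum>\<alpha>\<in>exponents n d. (\<lambda>_. c \<alpha>) * (\<Prod>i<n. y i ^ \<alpha> i)) x" for x
    by (simp add: c poly_function_def sum_fun_eval prod_fun_eval power_fun_eval)
  ultimately show ?thesis using that by blast
qed

lemma decseq_zero_sets_stabilises:
  fixes A :: "('x \<Rightarrow> 'k::field) set"
  assumes R: "noetherian_subring R" and A: "\<And>f. f \<in> A \<Longrightarrow> \<exists>r\<in>R. \<forall>x\<in>X. f x = r x"
    and Z: "\<And>k. \<exists>S\<subseteq>A. Z k = {x \<in> X. \<forall>f\<in>S. f x = 0}" and dec: "decseq Z"
  shows "\<exists>s. \<forall>k\<ge>s. Z k = Z s"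
proof -
  define I where "I k = {r \<in> R. \<forall>x\<in>Z k. r x = 0}" for k
  have sub: "unital_subring R" using R by (simp add: noetherian_subring_def)
  have ideal: "subring_ideal R (I k)" for k
    unfolding subring_ideal_def
  proof (intro conjI ballI)
    show "I k \<subseteq> R" by (auto simp: I_def)
    show "0 \<in> I k" using sub by (simp add: I_def unital_subring_def)
    show "a + b \<in> I k" if "a \<in> I k" "b \<in> I k" for a b
      using that sub by (simp add: I_def unital_subring_def)
    show "r * a \<in> I k" if "r \<in> R" "a \<in> I k" for r a
      using that sub by (simp add: I_def unital_subring_def)
  qed
  have inc: "incseq I" unfolding incseq_def
  proof (intro allI impI)
    fix k l :: nat assume "k \<le> l"
    then have "Z l \<subseteq> Z k" using dec by (simp add: decseqD)
    then show "I k \<subseteq> I l" by (auto simp: I_def)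
  qed
  have "incseq I \<and> (\<forall>k. subring_ideal R (I k)) \<longrightarrow> (\<exists>s. \<forall>k\<ge>s. I k = I s)"
    using R unfolding noetherian_subring_def by (elim conjE allE)
  with inc ideal have "\<exists>s. \<forall>k\<ge>s. I k = I s" by simp
  then obtain s where s: "\<forall>k\<ge>s. I k = I s" by (elim exE)
  have "Z k = {x \<in> X. \<forall>r\<in>I k. r x = 0}" for k
  proof -
    obtain S where S: "S \<subseteq> A" "Z k = {x \<in> X. \<forall>f\<in>S. f x = 0}"
      using Z[of k] by (elim exE conjE)
    have "(\<forall>f\<in>S. f x = 0) \<longleftrightarrow> (\<forall>r\<in>I k. r x = 0)" if x: "x \<in> X" for x
    proof
      assume "\<forall>f\<in>S. f x = 0"
      then have "x \<in> Z k" using x S(2) by simp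
      then show "\<forall>r\<in>I k. r x = 0" by (simp add: I_def)
    next
      assume vanish: "\<forall>r\<in>I k. r x = 0"
      show "\<forall>f\<in>S. f x = 0"
      proof
        fix f assume f: "f \<in> S"
        then obtain r where r: "r \<in> R" "\<forall>x\<in>X. f x = r x" using A S(1) by blast
        have "r y = 0" if "y \<in> Z k" for y
        proof -
          have "y \<in> X" "f y = 0" using that f by (simp_all add: S(2))
          then show ?thesis using r(2) by simp
        qed
        then have "r \<in> I k" using r(1) by (simp add: I_def)
        then show "f x = 0" using r(2) x vanish by simp
      qed
    qed
    then show ?thesis unfolding S(2) by (intro Collect_cong conj_cong refl)
  qed
  note Z_eq = this
  have "Z k = Z s" if "k \<ge> s" for k
    unfolding Z_eq[of k] Z_eq[of s] by (simp only: s[rule_format, OF that])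
  then show ?thesis by blast
qed

section \<open>The identity component\<close>

context linear_algebraic_group
begin

lemma coordinates:
  obtains n \<phi> where "\<And>x. x \<in> carrier G \<Longrightarrow> \<phi> x \<in> carrier_vec n"
    and "regular_functions G = {\<lambda>x\<in>carrier G. p (\<phi> x) | p. p \<in> poly_functions n}"
proof -
  obtain n \<phi> and S :: "('k vec \<Rightarrow> 'k) set"
    where "bij_betw \<phi> (carrier G) {v \<in> carrier_vec n. \<forall>p\<in>S. p v = 0}"
      and A: "regular_functions G = {\<lambda>x\<in>carrier G. p (\<phi> x) | p. p \<in> poly_functions n}"
    using variety unfolding affine_variety_def by blast
  then have "\<phi> x \<in> carrier_vec n" if "x \<in> carrier G" for x
    using that by (auto simp: bij_betw_def)
  then show ?thesis using A by (rule that)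
qed

lemma regular_poly:
  assumes p: "p \<in> poly_functions m"
    and h: "\<And>i. i < m \<Longrightarrow> restrict (h i) (carrier G) \<in> regular_functions G"
  shows "(\<lambda>x\<in>carrier G. p (vec m (\<lambda>i. h i x))) \<in> regular_functions G"
proof -
  obtain n \<phi> where \<phi>_vec: "\<And>x. x \<in> carrier G \<Longrightarrow> \<phi> x \<in> carrier_vec n"
    and A: "regular_functions G = {\<lambda>x\<in>carrier G. p (\<phi> x) | p. p \<in> poly_functions n}"
    by (rule coordinates) blast
  have "\<forall>i. \<exists>q d. i < m \<longrightarrow> q \<in> poly_functions_upto n d \<and> (\<forall>x\<in>carrier G. h i x = q (\<phi> x))"
  proof
    fix i
    show "\<exists>q d. i < m \<longrightarrow> q \<in> poly_functions_upto n d \<and> (\<forall>x\<in>carrier G. h i x = q (\<phi> x))"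
    proof (cases "i < m")
      case True
      from h[OF this] obtain q where q: "q \<in> poly_functions n"
        "restrict (h i) (carrier G) = (\<lambda>x\<in>carrier G. q (\<phi> x))" unfolding A by blast
      have "h i x = q (\<phi> x)" if "x \<in> carrier G" for x
        using fun_cong[OF q(2), of x] that by simp
      then show ?thesis using q(1) by (auto simp: poly_functions_def)
    qed simp
  qed
  then obtain q d where q: "\<And>i. i < m \<Longrightarrow> q i \<in> poly_functions_upto n (d i)"
    "\<And>i x. i < m \<Longrightarrow> x \<in> carrier G \<Longrightarrow> h i x = q i (\<phi> x)" by metis
  define D where "D = (\<Sum>i<m. d i)"
  have "restrict (q i) (carrier_vec n) \<in> poly_functions_upto n D" if "i < m" for i
  proof -
    have "d i \<le> D" unfolding D_def using that by (intro member_le_sum) auto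
    then show ?thesis using q(1)[OF that] poly_functions_upto_mono by auto
  qed
  moreover obtain e where e: "p \<in> poly_functions_upto m e" using p by (auto simp: poly_functions_def)
  ultimately have "(\<lambda>v\<in>carrier_vec n. p (vec m (\<lambda>i. q i v))) \<in> poly_functions_upto n (e * D)"
    by (intro poly_functions_upto_compose)
  then have "(\<lambda>v\<in>carrier_vec n. p (vec m (\<lambda>i. q i v))) \<in> poly_functions n"
    by (auto simp: poly_functions_def)
  then have "(\<lambda>x\<in>carrier G. (\<lambda>v\<in>carrier_vec n. p (vec m (\<lambda>i. q i v))) (\<phi> x)) \<in> regular_functions G"
    unfolding A by blast
  moreover have "vec m (\<lambda>i. q i (\<phi> x)) = vec m (\<lambda>i. h i x)" if "x \<in> carrier G" for x
    using q(2) that by (intro eq_vecI) auto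
  then have "(\<lambda>x\<in>carrier G. (\<lambda>v\<in>carrier_vec n. p (vec m (\<lambda>i. q i v))) (\<phi> x)) =
      (\<lambda>x\<in>carrier G. p (vec m (\<lambda>i. h i x)))"
    by (intro restrict_ext) (simp add: \<phi>_vec)
  ultimately show ?thesis by simp
qed

lemma regular_const: "(\<lambda>x\<in>carrier G. c) \<in> regular_functions G"
proof -
  have "(\<lambda>v\<in>carrier_vec 0. c) \<in> poly_functions 0"
    using poly_functions_upto_const by (auto simp: poly_functions_def)
  from regular_poly[OF this, of "\<lambda>_ _. 0"] show ?thesis by simp
qed

lemma regular_times:
  assumes "restrict f (carrier G) \<in> regular_functions G" "restrict g (carrier G) \<in> regular_functions G"
  shows "(\<lambda>x\<in>carrier G. f x * g x) \<in> regular_functions G"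
proof -
  have "(\<lambda>v\<in>carrier_vec 2. v $ 0 * v $ 1 :: 'k) \<in> poly_functions_upto 2 (1 + 1)"
    by (intro poly_functions_upto_mult poly_functions_upto_coord) auto
  then have "(\<lambda>v\<in>carrier_vec 2. v $ 0 * v $ 1 :: 'k) \<in> poly_functions 2"
    by (auto simp: poly_functions_def)
  from regular_poly[OF this, of "\<lambda>i. if i = 0 then f else g"] assms show ?thesis by auto
qed

lemma regular_linear:
  fixes m :: nat
  assumes "\<And>i. i < m \<Longrightarrow> restrict (f i) (carrier G) \<in> regular_functions G"
  shows "(\<lambda>x\<in>carrier G. \<Sum>i<m. c i * f i x) \<in> regular_functions G"
proof -
  have "(\<lambda>v\<in>carrier_vec m. \<Sum>i<m. c i * v $ i) \<in> poly_functions_upto m 1"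
    by (intro poly_functions_upto_sum poly_functions_upto_smult poly_functions_upto_coord) auto
  then have "(\<lambda>v\<in>carrier_vec m. \<Sum>i<m. c i * v $ i) \<in> poly_functions m"
    by (auto simp: poly_functions_def)
  from regular_poly[OF this assms] show ?thesis by simp
qed

lemma regular_restrict [simp]:
  "f \<in> regular_functions G \<Longrightarrow> restrict f (carrier G) = f"
  using variety by (auto simp: affine_variety_def)

abbreviation T where "T \<equiv> zariski_topology G"

lemma topspace_zariski [simp]: "topspace T = carrier G"
proof -
  have "carrier G - zero_locus G {\<lambda>x\<in>carrier G. 1} = carrier G"
    by (auto simp: zero_locus_def)
  moreover have "{\<lambda>x\<in>carrier G. 1} \<subseteq> regular_functions G" using regular_const by simp
  ultimately have "carrier G \<in> {carrier G - zero_locus G S | S. S \<subseteq> regular_functions G}" by blast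
  then show ?thesis unfolding zariski_topology_def topology_generated_by_topspace by blast
qed

lemma openin_zariski:
  "openin T U \<longleftrightarrow> (\<exists>S. S \<subseteq> regular_functions G \<and> U = carrier G - zero_locus G S)"
proof
  assume "openin T U"
  then have "generate_topology_on {carrier G - zero_locus G S | S. S \<subseteq> regular_functions G} U"
    by (simp add: zariski_topology_def openin_topology_generated_by_iff)
  then show "\<exists>S. S \<subseteq> regular_functions G \<and> U = carrier G - zero_locus G S"
  proof induction
    case Empty
    show ?case by (rule exI[of _ "{}"]) (auto simp: zero_locus_def)
  next
    case (Int U V)
    then obtain S S' where S: "S \<subseteq> regular_functions G" "U = carrier G - zero_locus G S"
      and S': "S' \<subseteq> regular_functions G" "V = carrier G - zero_locus G S'" by blast
    define P where "P = {\<lambda>x\<in>carrier G. f x * g x | f g. f \<in> S \<and> g \<in> S'}"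
    have "P \<subseteq> regular_functions G"
      using S S' by (auto simp: P_def intro!: regular_times)
    moreover have "zero_locus G P = zero_locus G S \<union> zero_locus G S'"
      by (fastforce simp: P_def zero_locus_def)
    ultimately show ?case using S S' by blast
  next
    case (UN K)
    then have "\<forall>U. \<exists>S. U \<in> K \<longrightarrow> S \<subseteq> regular_functions G \<and> U = carrier G - zero_locus G S" by blast
    then obtain S where S: "\<And>U. U \<in> K \<Longrightarrow> S U \<subseteq> regular_functions G"
      "\<And>U. U \<in> K \<Longrightarrow> U = carrier G - zero_locus G (S U)" by metis
    have "carrier G - zero_locus G (\<Union>U\<in>K. S U) = (\<Union>U\<in>K. carrier G - zero_locus G (S U))"
      by (auto simp: zero_locus_def)
    also have "\<dots> = \<Union>K" using S(2) by auto
    finally show ?case using S(1) by (intro exI[of _ "\<Union>U\<in>K. S U"]) auto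
  next
    case (Basis U)
    then show ?case by blast
  qed
next
  assume "\<exists>S. S \<subseteq> regular_functions G \<and> U = carrier G - zero_locus G S"
  then show "openin T U"
    unfolding zariski_topology_def by (intro topology_generated_by_Basis) blast
qed

lemma closedin_zariski:
  "closedin T Z \<longleftrightarrow> (\<exists>S. S \<subseteq> regular_functions G \<and> Z = zero_locus G S)"
proof -
  have "Z \<subseteq> carrier G \<and> carrier G - Z = carrier G - zero_locus G S \<longleftrightarrow> Z = zero_locus G S" for S
    by (auto simp: zero_locus_def)
  then show ?thesis unfolding closedin_def openin_zariski topspace_zariski by metis
qed

lemma wf_closedin_zariski: "wf {(Y, Z). closedin T Y \<and> closedin T Z \<and> Y \<subset> Z}"
  unfolding wf_iff_no_infinite_down_chain
proof
  assume "\<exists>Z. \<forall>i. (Z (Suc i), Z i) \<in> {(Y, Z). closedin T Y \<and> closedin T Z \<and> Y \<subset> Z}"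
  then obtain Z :: "nat \<Rightarrow> 'a set"
    where chain: "\<forall>i. (Z (Suc i), Z i) \<in> {(Y, Z). closedin T Y \<and> closedin T Z \<and> Y \<subset> Z}"
    by (elim exE)
  then have Z: "closedin T (Z i)" "Z (Suc i) \<subset> Z i" for i by simp_all
  obtain n \<phi> where \<phi>_vec: "\<And>x. x \<in> carrier G \<Longrightarrow> \<phi> x \<in> carrier_vec n"
    and A: "regular_functions G = {\<lambda>x\<in>carrier G. p (\<phi> x) | p. p \<in> poly_functions n}"
    by (rule coordinates) blast
  obtain R where R: "noetherian_subring R" "\<And>c::'k. (\<lambda>_. c) \<in> R" "\<And>i. i < n \<Longrightarrow> (\<lambda>x. \<phi> x $ i) \<in> R"
    by (rule noetherian_subring_generated[where y = "\<lambda>i x. \<phi> x $ i" and n = n]) (rule that)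
  have sub: "unital_subring R" using R(1) by (simp add: noetherian_subring_def)
  have "\<exists>s. \<forall>k\<ge>s. Z k = Z s"
  proof (rule decseq_zero_sets_stabilises[OF R(1)])
    fix f assume "f \<in> regular_functions G"
    then obtain p where p: "p \<in> poly_functions n" "f = (\<lambda>x\<in>carrier G. p (\<phi> x))" unfolding A by blast
    obtain r where r: "r \<in> R" "\<And>x. p (vec n (\<lambda>i. \<phi> x $ i)) = r x"
      by (rule poly_function_in_subring[where y = "\<lambda>i x. \<phi> x $ i", OF sub R(2) R(3) p(1)]) (assumption, rule that)
    have "vec n (\<lambda>i. \<phi> x $ i) = \<phi> x" if "x \<in> carrier G" for x
      using \<phi>_vec[OF that] by (intro eq_vecI) auto
    then have "f x = r x" if "x \<in> carrier G" for x using r(2)[of x] that by (simp add: p(2))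
    then show "\<exists>r\<in>R. \<forall>x\<in>carrier G. f x = r x" using r(1) by blast
  next
    show "\<exists>S\<subseteq>regular_functions G. Z k = {x \<in> carrier G. \<forall>f\<in>S. f x = 0}" for k
      using Z(1)[of k] unfolding closedin_zariski zero_locus_def by blast
    show "decseq Z" using Z(2) by (intro decseq_SucI) blast
  qed
  then show False using Z(2) by (metis le_SucI order_refl psubset_eq)
qed

lemma clopen_finite_union_connected:
  assumes "closedin T C" "openin T C"
  shows "\<exists>\<C>. finite \<C> \<and> (\<forall>D\<in>\<C>. connectedin T D) \<and> C = \<Union>\<C>"
  using wf_closedin_zariski assms
proof (induction C rule: wf_induct_rule)
  case (less C)
  show ?case
  proof (cases "connectedin T C")
    case True
    then show ?thesis by (intro exI[of _ "{C}"]) auto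
  next
    case False
    have "C \<subseteq> topspace T" using less.prems closedin_subset by blast
    with False obtain E F where E: "closedin T E" and F: "closedin T F" and CEF: "C \<subseteq> E \<union> F"
      "E \<inter> F \<inter> C = {}" "E \<inter> C \<noteq> {}" "F \<inter> C \<noteq> {}"
      unfolding connectedin_closedin by blast
    have split: "C \<inter> E = C - F" "C \<inter> F = C - E" using CEF by auto
    have clopen: "closedin T (C \<inter> E)" "closedin T (C \<inter> F)" "openin T (C \<inter> E)" "openin T (C \<inter> F)"
      using less.prems E F by (simp_all add: closedin_Int, simp_all add: split openin_diff)
    have sub: "C \<inter> E \<subset> C" "C \<inter> F \<subset> C" using CEF by auto
    obtain \<C> where \<C>: "finite \<C>" "\<forall>D\<in>\<C>. connectedin T D" "C \<inter> E = \<Union>\<C>"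
      using less.IH[of "C \<inter> E"] clopen sub less.prems by auto
    obtain \<D> where \<D>: "finite \<D>" "\<forall>D\<in>\<D>. connectedin T D" "C \<inter> F = \<Union>\<D>"
      using less.IH[of "C \<inter> F"] clopen sub less.prems by auto
    have "C = (C \<inter> E) \<union> (C \<inter> F)" using CEF(1) by blast
    then have "C = \<Union>(\<C> \<union> \<D>)" unfolding \<C>(3) \<D>(3) Union_Un_distrib .
    then show ?thesis using \<C> \<D> by (intro exI[of _ "\<C> \<union> \<D>"]) auto
  qed
qed

lemma continuous_zariski:
  assumes \<tau>: "\<And>x. x \<in> carrier G \<Longrightarrow> \<tau> x \<in> carrier G"
    and reg: "\<And>f. f \<in> regular_functions G \<Longrightarrow> (\<lambda>x\<in>carrier G. f (\<tau> x)) \<in> regular_functions G"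
  shows "continuous_map T T \<tau>"
  unfolding continuous_map_def
proof (intro conjI allI impI)
  show "\<tau> \<in> topspace T \<rightarrow> topspace T" using \<tau> by auto
  fix U assume "openin T U"
  then obtain S where S: "S \<subseteq> regular_functions G" "U = carrier G - zero_locus G S"
    unfolding openin_zariski by blast
  have "{x \<in> topspace T. \<tau> x \<in> U} = carrier G - zero_locus G ((\<lambda>f. \<lambda>x\<in>carrier G. f (\<tau> x)) ` S)"
    using \<tau> by (auto simp: S zero_locus_def)
  moreover have "(\<lambda>f. \<lambda>x\<in>carrier G. f (\<tau> x)) ` S \<subseteq> regular_functions G"
    using reg S by blast
  ultimately show "openin T {x \<in> topspace T. \<tau> x \<in> U}" unfolding openin_zariski by blast
qed

lemma regular_translate:
  assumes f: "f \<in> regular_functions G" and a: "a \<in> carrier G"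
  shows "(\<lambda>x\<in>carrier G. f (a \<otimes> x)) \<in> regular_functions G"
    and "(\<lambda>x\<in>carrier G. f (x \<otimes> a)) \<in> regular_functions G"
proof -
  obtain m :: nat and g h where gh: "\<And>i. i < m \<Longrightarrow> g i \<in> regular_functions G \<and> h i \<in> regular_functions G"
    "\<And>x y. x \<in> carrier G \<Longrightarrow> y \<in> carrier G \<Longrightarrow> f (x \<otimes> y) = (\<Sum>i<m. g i x * h i y)"
    using regular_mult[OF f] by blast
  have "(\<lambda>x\<in>carrier G. \<Sum>i<m. g i a * h i x) \<in> regular_functions G"
    by (intro regular_linear) (use gh in simp)
  moreover have "(\<lambda>x\<in>carrier G. \<Sum>i<m. h i a * g i x) \<in> regular_functions G"
    by (intro regular_linear) (use gh in simp)
  moreover have "(\<lambda>x\<in>carrier G. f (a \<otimes> x)) = (\<lambda>x\<in>carrier G. \<Sum>i<m. g i a * h i x)"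
    "(\<lambda>x\<in>carrier G. f (x \<otimes> a)) = (\<lambda>x\<in>carrier G. \<Sum>i<m. h i a * g i x)"
    using gh(2) a by (auto intro!: restrict_ext simp: mult.commute)
  ultimately show "(\<lambda>x\<in>carrier G. f (a \<otimes> x)) \<in> regular_functions G"
    "(\<lambda>x\<in>carrier G. f (x \<otimes> a)) \<in> regular_functions G" by simp_all
qed

lemma continuous_map_left_translation: "a \<in> carrier G \<Longrightarrow> continuous_map T T (\<lambda>x. a \<otimes> x)"
  by (intro continuous_zariski regular_translate) auto

lemma continuous_map_right_translation: "a \<in> carrier G \<Longrightarrow> continuous_map T T (\<lambda>x. x \<otimes> a)"
  by (intro continuous_zariski regular_translate) auto

lemma continuous_map_inv: "continuous_map T T (\<lambda>x. inv x)"
  by (intro continuous_zariski regular_inv) auto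

abbreviation N where "N \<equiv> identity_component_set G"

lemma identity_component_subset: "N \<subseteq> carrier G"
  using connected_component_of_subset_topspace[of T \<one>] by (simp add: identity_component_set_def)

lemma connectedin_identity_component: "connectedin T N"
  by (simp add: identity_component_set_def connectedin_connected_component_of)

lemma one_in_identity_component: "\<one> \<in> N"
  by (simp add: identity_component_set_def connected_component_of_refl)

lemma connectedin_subset_identity_component:
  assumes "connectedin T C" "x \<in> C" "x \<in> N"
  shows "C \<subseteq> N"
proof -
  have "connectedin T (C \<union> N)"
    using assms connectedin_identity_component by (intro connectedin_Un) auto
  then have "C \<union> N \<subseteq> N"
    using one_in_identity_component
    unfolding identity_component_set_def by (intro connected_component_of_maximal) auto
  then show ?thesis by blast
qed

lemma subgroup_identity_component: "subgroup N G"
proof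
  show "N \<subseteq> carrier G" by (rule identity_component_subset)
  show "\<one> \<in> N" by (rule one_in_identity_component)
next
  fix x y assume x: "x \<in> N" and y: "y \<in> N"
  have xG: "x \<in> carrier G" using x identity_component_subset by blast
  have "connectedin T ((\<lambda>y. x \<otimes> y) ` N)"
    by (rule connectedin_continuous_map_image[OF continuous_map_left_translation[OF xG] connectedin_identity_component])
  moreover have "x \<in> (\<lambda>y. x \<otimes> y) ` N"
    using one_in_identity_component xG by (intro image_eqI[of _ _ \<one>]) auto
  ultimately have "(\<lambda>y. x \<otimes> y) ` N \<subseteq> N" using x by (rule connectedin_subset_identity_component)
  then show "x \<otimes> y \<in> N" using y by blast
next
  fix x assume x: "x \<in> N"
  have "connectedin T ((\<lambda>x. inv x) ` N)"
    by (rule connectedin_continuous_map_image[OF continuous_map_inv connectedin_identity_component])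
  moreover have "\<one> \<in> (\<lambda>x. inv x) ` N"
    using one_in_identity_component by (intro image_eqI[of _ _ \<one>]) auto
  ultimately have "(\<lambda>x. inv x) ` N \<subseteq> N"
    using one_in_identity_component by (rule connectedin_subset_identity_component)
  then show "inv x \<in> N" using x by blast
qed

lemma normal_identity_component: "N \<lhd> G"
proof (rule normal_invI[OF subgroup_identity_component])
  fix a h assume a: "a \<in> carrier G" and h: "h \<in> N"
  have "continuous_map T T ((\<lambda>x. x \<otimes> inv a) \<circ> (\<lambda>x. a \<otimes> x))"
    using a by (intro continuous_map_compose[OF continuous_map_left_translation
          continuous_map_right_translation]) auto
  then have "connectedin T (((\<lambda>x. x \<otimes> inv a) \<circ> (\<lambda>x. a \<otimes> x)) ` N)"
    by (rule connectedin_continuous_map_image) (rule connectedin_identity_component)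
  moreover have "\<one> \<in> ((\<lambda>x. x \<otimes> inv a) \<circ> (\<lambda>x. a \<otimes> x)) ` N"
    using one_in_identity_component a by (intro image_eqI[of _ _ \<one>]) auto
  ultimately have "((\<lambda>x. x \<otimes> inv a) \<circ> (\<lambda>x. a \<otimes> x)) ` N \<subseteq> N"
    using one_in_identity_component by (rule connectedin_subset_identity_component)
  then show "a \<otimes> h \<otimes> inv a \<in> N" using h by auto
qed

lemma finite_index_identity_component: "finite (rcosets N)"
proof -
  obtain \<C> where \<C>: "finite \<C>" "\<And>D. D \<in> \<C> \<Longrightarrow> connectedin T D" "carrier G = \<Union>\<C>"
    using clopen_finite_union_connected[of "carrier G"] closedin_topspace[of T] openin_topspace[of T]
    by auto
  have "N #> x = N #> y" if D: "D \<in> \<C>" "x \<in> D" "y \<in> D" for D x y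
  proof -
    have G: "x \<in> carrier G" "y \<in> carrier G" using D \<C>(3) by auto
    have "connectedin T ((\<lambda>z. z \<otimes> inv x) ` D)"
      using G \<C>(2) D by (intro connectedin_continuous_map_image[OF continuous_map_right_translation]) auto
    moreover have "\<one> \<in> (\<lambda>z. z \<otimes> inv x) ` D" using D G by (intro image_eqI[of _ _ x]) auto
    ultimately have "(\<lambda>z. z \<otimes> inv x) ` D \<subseteq> N"
      using one_in_identity_component by (rule connectedin_subset_identity_component)
    then have "y \<otimes> inv x \<in> N" using D by blast
    then have "y \<in> N #> x"
      unfolding r_coset_def using G by (auto intro!: bexI[of _ "y \<otimes> inv x"] simp: m_assoc)
    then show ?thesis using G subgroup_identity_component by (intro repr_independence)
  qed
  note same = this
  have "rcosets N \<subseteq> (\<lambda>D. N #> (SOME x. x \<in> D)) ` \<C>"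
  proof
    fix K assume "K \<in> rcosets N"
    then obtain x where x: "x \<in> carrier G" "K = N #> x" by (auto simp: RCOSETS_def)
    then obtain D where D: "D \<in> \<C>" "x \<in> D" using \<C>(3) by blast
    then have "K = N #> (SOME x. x \<in> D)" unfolding x(2) by (intro same[of D] someI[of "\<lambda>x. x \<in> D"])
    then show "K \<in> (\<lambda>D. N #> (SOME x. x \<in> D)) ` \<C>" using D(1) by blast
  qed
  then show ?thesis using \<C>(1) finite_surj by blast
qed

end

section \<open>Invariants and the delta number\<close>

lemma invariants_iff:
  fixes G :: "('a, 'k::field) algebraic_group"
  assumes "group G"
  shows "f \<in> invariants G n \<rho> \<longleftrightarrow> f \<in> poly_functions n \<and>
    (\<forall>g\<in>carrier G. \<forall>v\<in>carrier_vec n. f (\<rho> g *\<^sub>v v) = f v)"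
proof -
  interpret group G by fact
  have act: "act_on_function G n \<rho> g f = f \<longleftrightarrow> (\<forall>v\<in>carrier_vec n. f (\<rho> (inv\<^bsub>G\<^esub> g) *\<^sub>v v) = f v)"
    if "f \<in> poly_functions n" for g
  proof -
    have "restrict f (carrier_vec n) = f" using that by (auto simp: poly_functions_def)
    then have "act_on_function G n \<rho> g f = f \<longleftrightarrow>
        (\<lambda>v\<in>carrier_vec n. f (\<rho> (inv\<^bsub>G\<^esub> g) *\<^sub>v v)) = restrict f (carrier_vec n)"
      by (simp add: act_on_function_def)
    also have "\<dots> \<longleftrightarrow> (\<forall>v\<in>carrier_vec n. f (\<rho> (inv\<^bsub>G\<^esub> g) *\<^sub>v v) = f v)"
      by (auto simp: fun_eq_iff restrict_def)
    finally show ?thesis .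
  qed
  have "(\<forall>g\<in>carrier G. P (inv\<^bsub>G\<^esub> g)) \<longleftrightarrow> (\<forall>g\<in>carrier G. P g)" for P
    by (metis inv_closed inv_inv)
  from this[of "\<lambda>g. \<forall>v\<in>carrier_vec n. f (\<rho> g *\<^sub>v v) = f v"] show ?thesis
    by (auto simp: invariants_def act)
qed

lemma delta_set_invariants_upto_iff:
  "delta_set G n \<rho> (invariants_upto G n \<rho> d) \<longleftrightarrow>
     (\<forall>v\<in>fixed_points G n \<rho> - nullcone G n \<rho>.
        \<exists>f\<in>invariants G n \<rho> \<inter> poly_functions_upto n d. f (0\<^sub>v n) = 0 \<and> f v \<noteq> 0)"
  by (auto simp: delta_set_def invariants_upto_def plus_part_def constant_term_def)

lemma delta_module_le_iff:
  "delta_module G n \<rho> \<le> enat d \<longleftrightarrow> delta_set G n \<rho> (invariants_upto G n \<rho> d)"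
proof
  define D where "D = {enat d | d. delta_set G n \<rho> (invariants_upto G n \<rho> d)}"
  assume "delta_module G n \<rho> \<le> enat d"
  then have le: "Inf D \<le> enat d" by (simp add: delta_module_def D_def)
  then have "D \<noteq> {}" by (auto simp: Inf_enat_def)
  then have "Inf D \<in> D" unfolding Inf_enat_def by (auto intro: LeastI)
  then obtain e where e: "Inf D = enat e" "delta_set G n \<rho> (invariants_upto G n \<rho> e)"
    by (auto simp: D_def)
  then have "poly_functions_upto n e \<subseteq> (poly_functions_upto n d :: ('b vec \<Rightarrow> 'b) set)"
    using le poly_functions_upto_mono by auto
  then show "delta_set G n \<rho> (invariants_upto G n \<rho> d)"
    using e(2) unfolding delta_set_invariants_upto_iff by blast
next
  assume "delta_set G n \<rho> (invariants_upto G n \<rho> d)"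
  then show "delta_module G n \<rho> \<le> enat d"
    unfolding delta_module_def by (intro Inf_lower) blast
qed

lemma delta_le_iff:
  "delta G \<le> enat d \<longleftrightarrow> (\<forall>n \<rho>. rational_rep G n \<rho> \<longrightarrow> delta_set G n \<rho> (invariants_upto G n \<rho> d))"
  unfolding delta_def Sup_le_iff by (auto simp: delta_module_le_iff[symmetric])

lemma zero_in_nullcone: "0\<^sub>v n \<in> nullcone G n \<rho>"
  by (auto simp: nullcone_def plus_part_def constant_term_def)

lemma rational_rep_mult_vec:
  assumes "rational_rep G n \<rho>" "g \<in> carrier G" "h \<in> carrier G" "v \<in> carrier_vec n"
  shows "\<rho> (g \<otimes>\<^bsub>G\<^esub> h) *\<^sub>v v = \<rho> g *\<^sub>v (\<rho> h *\<^sub>v v)"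
proof -
  have "\<rho> g \<in> carrier_mat n n" "\<rho> h \<in> carrier_mat n n"
    using assms by (auto simp: rational_rep_def)
  then show ?thesis using assms by (simp add: rational_rep_def assoc_mult_mat_vec)
qed

lemma finite_group_separates:
  fixes Q :: "('a, 'k::field) algebraic_group"
  assumes "group Q" "finite (carrier Q)" and rep: "rational_rep Q m \<sigma>"
    and v: "v \<in> fixed_points Q m \<sigma>" "v \<noteq> 0\<^sub>v m"
  shows "\<exists>f\<in>invariants Q m \<sigma> \<inter> poly_functions_upto m (card (carrier Q)). f (0\<^sub>v m) = 0 \<and> f v \<noteq> 0"
proof -
  interpret group Q by fact
  have \<sigma>: "\<sigma> q \<in> carrier_mat m m" if "q \<in> carrier Q" for q
    using rep that by (auto simp: rational_rep_def)
  have v_vec: "v \<in> carrier_vec m" using v by (simp add: fixed_points_def)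
  then obtain i where i: "i < m" "v $ i \<noteq> 0"
    using v(2) by (metis carrier_vecD eq_vecI index_zero_vec)
  \<comment> \<open>the norm of the \<open>i\<close>-th coordinate form\<close>
  define f where "f = (\<lambda>u\<in>carrier_vec m. \<Prod>q\<in>carrier Q. (\<sigma> q *\<^sub>v u) $ i)"
  have "f \<in> poly_functions_upto m (\<Sum>q\<in>carrier Q. 1)"
    unfolding f_def
  proof (intro poly_functions_upto_prod assms(2))
    fix q assume q: "q \<in> carrier Q"
    have "(\<lambda>u\<in>carrier_vec m. (\<lambda>u\<in>carrier_vec m. u $ i :: 'k) (\<sigma> q *\<^sub>v u)) \<in> poly_functions_upto m 1"
      using i \<sigma>[OF q] by (intro poly_functions_upto_mult_mat[of _ m] poly_functions_upto_coord)
    moreover have "(\<lambda>u\<in>carrier_vec m. (\<lambda>u\<in>carrier_vec m. u $ i :: 'k) (\<sigma> q *\<^sub>v u)) =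
        (\<lambda>u\<in>carrier_vec m. (\<sigma> q *\<^sub>v u) $ i)"
      using \<sigma>[OF q] by (intro restrict_ext) simp
    ultimately show "(\<lambda>u\<in>carrier_vec m. (\<sigma> q *\<^sub>v u) $ i) \<in> poly_functions_upto m 1" by simp
  qed
  then have deg: "f \<in> poly_functions_upto m (card (carrier Q))" by simp
  have "f (\<sigma> h *\<^sub>v u) = f u" if h: "h \<in> carrier Q" and u: "u \<in> carrier_vec m" for h u
  proof -
    have "bij_betw (\<lambda>q. q \<otimes>\<^bsub>Q\<^esub> h) (carrier Q) (carrier Q)"
      by (rule bij_betw_byWitness[where f' = "\<lambda>q. q \<otimes>\<^bsub>Q\<^esub> inv\<^bsub>Q\<^esub> h"])
        (use h in \<open>auto simp: m_assoc\<close>)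
    then have "(\<Prod>q\<in>carrier Q. (\<sigma> (q \<otimes>\<^bsub>Q\<^esub> h) *\<^sub>v u) $ i) = (\<Prod>q\<in>carrier Q. (\<sigma> q *\<^sub>v u) $ i)"
      by (rule prod.reindex_bij_betw)
    then show ?thesis
      using h u \<sigma>[OF h] by (simp add: f_def rational_rep_mult_vec[OF rep])
  qed
  then have inv: "f \<in> invariants Q m \<sigma>"
    using deg by (auto simp: invariants_iff[OF assms(1)] poly_functions_def)
  have "f v = (\<Prod>q\<in>carrier Q. v $ i)"
    using v by (simp add: f_def fixed_points_def)
  then have "f v \<noteq> 0" using i by simp
  moreover have "(\<sigma> q *\<^sub>v 0\<^sub>v m) $ i = 0" if "q \<in> carrier Q" for q
    using \<sigma>[OF that] i by (simp add: scalar_prod_def)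
  then have "f (0\<^sub>v m) = 0" using assms(2) one_closed by (auto simp: f_def card_gt_0_iff)
  ultimately show ?thesis using deg inv by blast
qed

lemma delta_finite_group:
  fixes Q :: "('a, 'k::field) algebraic_group"
  assumes "group Q" "finite (carrier Q)"
  shows "delta Q \<le> enat (card (carrier Q))"
  unfolding delta_le_iff
proof (intro allI impI)
  fix n \<rho> assume "rational_rep Q n \<rho>"
  then show "delta_set Q n \<rho> (invariants_upto Q n \<rho> (card (carrier Q)))"
    unfolding delta_set_invariants_upto_iff
    using finite_group_separates[OF assms] zero_in_nullcone by (metis DiffE)
qed

lemma delta_nonzero:
  fixes Q :: "('a, 'k::field) algebraic_group"
  assumes const: "\<And>c. (\<lambda>x\<in>carrier Q. c) \<in> regular_functions Q" and "group Q"
  shows "delta Q \<noteq> 0"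
proof
  define \<rho> :: "'a \<Rightarrow> 'k mat" where "\<rho> = (\<lambda>_. 1\<^sub>m 1)"
  define v :: "'k vec" where "v = vec 1 (\<lambda>_. 1)"
  define l :: "'k vec \<Rightarrow> 'k" where "l = (\<lambda>v\<in>carrier_vec 1. v $ 0)"
  assume "delta Q = 0"
  moreover have "rational_rep Q 1 \<rho>"
    using const by (auto simp: rational_rep_def \<rho>_def)
  ultimately have set: "delta_set Q 1 \<rho> (invariants_upto Q 1 \<rho> 0)"
    using delta_le_iff[of Q 0] by (simp add: zero_enat_def)
  have v_vec: "v \<in> carrier_vec 1" by (simp add: v_def)
  have "l \<in> poly_functions_upto 1 1" unfolding l_def by (rule poly_functions_upto_coord) simp
  then have "l \<in> invariants Q 1 \<rho>"
    by (auto simp: invariants_iff[OF assms(2)] poly_functions_def \<rho>_def)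
  then have "v \<notin> nullcone Q 1 \<rho>"
    by (force simp: nullcone_def plus_part_def constant_term_def l_def v_def)
  moreover have "v \<in> fixed_points Q 1 \<rho>" using v_vec by (simp add: fixed_points_def \<rho>_def)
  ultimately obtain f where f: "f \<in> poly_functions_upto 1 0" "f (0\<^sub>v 1) = 0" "f v \<noteq> 0"
    using set unfolding delta_set_invariants_upto_iff by blast
  have "exponents 1 0 = {\<lambda>_. 0}"
    by (auto simp: exponents_def fun_eq_iff less_Suc_eq_0_disj) (metis One_nat_def less_one not_le_imp_less)
  moreover obtain c where "f = poly_function 1 0 c" using f(1) by (auto simp: poly_functions_upto_def)
  ultimately have "f w = c (\<lambda>_. 0)" if "w \<in> carrier_vec 1" for w
    using that by (simp add: poly_function_def del: One_nat_def)
  then have "f v = f (0\<^sub>v 1)" using v_vec by simp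
  then show False using f by simp
qed

lemma group_closed_subgroup:
  assumes "group G" "subgroup H G"
  shows "group (closed_subgroup G H)"
proof -
  interpret group G by fact
  interpret subgroup H G by fact
  show ?thesis
    by (rule groupI) (auto simp: closed_subgroup_def m_assoc intro!: bexI[of _ "inv\<^bsub>G\<^esub> x" for x])
qed

lemma group_quotient_group:
  assumes "H \<lhd> G"
  shows "group (quotient_group G H)"
proof -
  interpret Q: group "G Mod H" using assms by (rule normal.factorgroup_is_group)
  show ?thesis
    by (rule groupI) (use Q.m_closed Q.one_closed Q.m_assoc Q.l_one Q.l_inv_ex in \<open>simp_all del: mult_FactGroup carrier_FactGroup one_FactGroup\<close>)
qed

section \<open>The quotient module\<close>

lemma poly_functions_upto_interpolation:
  fixes W :: "('k::field vec \<Rightarrow> 'k) set"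
  assumes W: "W \<subseteq> poly_functions_upto n d"
    and lin: "\<And>(m::nat) a h. (\<And>i. i < m \<Longrightarrow> h i \<in> W) \<Longrightarrow> (\<lambda>v\<in>carrier_vec n. \<Sum>i<m. a i * h i v) \<in> W"
  obtains m u h where "\<forall>i<m. u i \<in> carrier_vec n" "\<forall>i<m. h i \<in> W"
    "\<forall>i<m. \<forall>j<m. h i (u j) = (if i = j then 1 else 0)"
    "\<forall>f\<in>W. \<forall>x\<in>carrier_vec n. f x = (\<Sum>i<(m::nat). f (u i) * h i x)"
proof -
  obtain b where b: "bij_betw b {0..<card (exponents n d)} (exponents n d)"
    using ex_bij_betw_nat_finite[OF finite_exponents] by blast
  define e :: "nat \<Rightarrow> 'k vec \<Rightarrow> 'k" where "e = (\<lambda>l v. \<Prod>i<n. (v $ i) ^ b l i)"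
  have span: "\<exists>c. \<forall>v\<in>carrier_vec n. f v = (\<Sum>l<card (exponents n d). c l * e l v)" if f: "f \<in> W" for f
  proof -
    obtain c where c: "f = poly_function n d c" using W f by (auto simp: poly_functions_upto_def)
    have "f v = (\<Sum>l<card (exponents n d). c (b l) * e l v)" if "v \<in> carrier_vec n" for v
    proof -
      have "(\<Sum>\<alpha>\<in>exponents n d. c \<alpha> * (\<Prod>i<n. (v $ i) ^ \<alpha> i)) =
          (\<Sum>l\<in>{0..<card (exponents n d)}. c (b l) * (\<Prod>i<n. (v $ i) ^ b l i))"
        by (rule sum.reindex_bij_betw[OF b, symmetric])
      then show ?thesis using that by (simp add: c poly_function_def e_def atLeast0LessThan)
    qed
    then show ?thesis by (intro exI[of _ "\<lambda>l. c (b l)"]) simp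
  qed
  have comb: "\<exists>k\<in>W. \<forall>x\<in>carrier_vec n. k x = (\<Sum>i<m. a i * h i x)"
    if "\<And>i. i < m \<Longrightarrow> h i \<in> W" for m :: nat and a h
    using lin[of m h a] that by (intro bexI[of _ "\<lambda>v\<in>carrier_vec n. \<Sum>i<m. a i * h i v"]) auto
  show ?thesis
    by (rule interpolation[where W = W and X = "carrier_vec n" and M = "card (exponents n d)" and e = e, OF comb span])
       (assumption, assumption, rule that)
qed

context linear_algebraic_group
begin

lemma identity_component_simps [simp]:
  "carrier (identity_component G) = N"
  "mult (identity_component G) = mult G"
  "one (identity_component G) = one G"
  "regular_functions (identity_component G) = (\<lambda>f. restrict f N) ` regular_functions G"
  by (simp_all add: identity_component_def closed_subgroup_def)

lemma group_identity_component: "group (identity_component G)"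
  unfolding identity_component_def
  by (intro group_closed_subgroup is_group subgroup_identity_component)

abbreviation Q where "Q \<equiv> quotient_group G N"

lemma group_Q: "group Q"
  by (rule group_quotient_group[OF normal_identity_component])

lemma carrier_Q: "carrier Q = (\<lambda>g. N #> g) ` carrier G"
  by (simp add: carrier_FactGroup)

lemma finite_carrier_Q: "finite (carrier Q)"
  using finite_index_identity_component by (simp add: FactGroup_def)

lemma mult_Q:
  "g \<in> carrier G \<Longrightarrow> h \<in> carrier G \<Longrightarrow> (N #> g) \<otimes>\<^bsub>Q\<^esub> (N #> h) = N #> (g \<otimes> h)"
  by (simp add: normal.rcos_sum[OF normal_identity_component])

lemma regular_const_Q: "(\<lambda>x\<in>carrier Q. c) \<in> regular_functions Q"
proof -
  have "(\<lambda>x\<in>carrier G. (\<lambda>x\<in>carrier Q. c) (N #> x)) = (\<lambda>x\<in>carrier G. c)"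
    by (intro restrict_ext) (simp add: carrier_FactGroup)
  then show ?thesis using regular_const[of c] by simp
qed

lemma rational_rep_identity_component:
  assumes "rational_rep G n \<rho>"
  shows "rational_rep (identity_component G) n \<rho>"
proof -
  have "(\<lambda>g\<in>N. \<rho> g $$ (i, j)) \<in> (\<lambda>f. restrict f N) ` regular_functions G" if "i < n" "j < n" for i j
  proof (rule image_eqI)
    show "(\<lambda>g\<in>carrier G. \<rho> g $$ (i, j)) \<in> regular_functions G"
      using assms that by (simp add: rational_rep_def)
    show "(\<lambda>g\<in>N. \<rho> g $$ (i, j)) = restrict (\<lambda>g\<in>carrier G. \<rho> g $$ (i, j)) N"
      using identity_component_subset by (auto simp: restrict_def fun_eq_iff)
  qed
  then show ?thesis
    using assms by (auto simp: rational_rep_def subsetD[OF identity_component_subset])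
qed

lemma delta_set_product:
  assumes rep: "rational_rep G n \<rho>"
    and d: "delta (identity_component G) \<le> enat d" and e: "delta Q \<le> enat e"
  shows "delta_set G n \<rho> (invariants_upto G n \<rho> (e * d))"
  unfolding delta_set_invariants_upto_iff
proof
  fix v assume v: "v \<in> fixed_points G n \<rho> - nullcone G n \<rho>"
  note NG = subsetD[OF identity_component_subset]
  have \<rho>: "\<rho> g \<in> carrier_mat n n" if "g \<in> carrier G" for g
    using rep that by (auto simp: rational_rep_def)
  have \<rho>_vec: "\<rho> g *\<^sub>v w \<in> carrier_vec n" if "g \<in> carrier G" "w \<in> carrier_vec n" for g w
    using \<rho>[OF that(1)] that(2) by simp
  have \<rho>_one: "\<rho> \<one> *\<^sub>v w = w" if "w \<in> carrier_vec n" for w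
    using rep that by (simp add: rational_rep_def)
  note \<rho>_mult = rational_rep_mult_vec[OF rep]
  have \<rho>_zero: "\<rho> g *\<^sub>v 0\<^sub>v n = 0\<^sub>v n" if "g \<in> carrier G" for g
    using \<rho>[OF that] by (intro eq_vecI) (auto simp: scalar_prod_def)
  have v_vec: "v \<in> carrier_vec n" using v by (simp add: fixed_points_def)

  define W where "W = {f \<in> poly_functions_upto n d. f (0\<^sub>v n) = 0 \<and>
    (\<forall>x\<in>N. \<forall>w\<in>carrier_vec n. f (\<rho> x *\<^sub>v w) = f w)}"
  have W_inv: "f (\<rho> x *\<^sub>v w) = f w" if "f \<in> W" "x \<in> N" "w \<in> carrier_vec n" for f x w
    using that by (simp add: W_def)
  have W_zero: "f (0\<^sub>v n) = 0" if "f \<in> W" for f using that by (simp add: W_def)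
  have W_poly: "W \<subseteq> poly_functions_upto n d" by (auto simp: W_def)
  have W_lin: "(\<lambda>w\<in>carrier_vec n. \<Sum>i<m. a i * h i w) \<in> W"
    if h: "\<And>i. i < m \<Longrightarrow> h i \<in> W" for m :: nat and a h
  proof -
    have "restrict (h i) (carrier_vec n) \<in> poly_functions_upto n d" if "i < m" for i
      using subsetD[OF W_poly h[OF that]] by simp
    then have "(\<lambda>w\<in>carrier_vec n. \<Sum>i<m. a i * h i w) \<in> poly_functions_upto n d"
      by (intro poly_functions_upto_sum poly_functions_upto_smult) simp
    then show ?thesis using h NG by (auto simp: W_def \<rho>_vec)
  qed
  have W_translate: "(\<lambda>w\<in>carrier_vec n. f (\<rho> g *\<^sub>v w)) \<in> W" if f: "f \<in> W" and g: "g \<in> carrier G" for f g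
  proof -
    have "f (\<rho> g *\<^sub>v (\<rho> x *\<^sub>v w)) = f (\<rho> g *\<^sub>v w)" if x: "x \<in> N" and w: "w \<in> carrier_vec n" for x w
    proof -
      have x': "x \<in> carrier G" using x NG by blast
      have "g \<otimes> x \<otimes> inv g \<in> N"
        using normal_invE(2)[OF normal_identity_component g x] .
      moreover have "(g \<otimes> x \<otimes> inv g) \<otimes> g = g \<otimes> x" using g x' by (simp add: m_assoc)
      then have "\<rho> (g \<otimes> x \<otimes> inv g) *\<^sub>v (\<rho> g *\<^sub>v w) = \<rho> g *\<^sub>v (\<rho> x *\<^sub>v w)"
        using g x' w \<rho>_mult[of "g \<otimes> x \<otimes> inv g" g w] \<rho>_mult[of g x w] by simp
      ultimately show ?thesis
        using W_inv[OF f, of "g \<otimes> x \<otimes> inv g" "\<rho> g *\<^sub>v w"] \<rho>_vec[OF g w] by simp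
    qed
    moreover have "(\<lambda>w\<in>carrier_vec n. f (\<rho> g *\<^sub>v w)) \<in> poly_functions_upto n d"
      using f \<rho>[OF g] by (intro poly_functions_upto_mult_mat) (auto simp: W_def)
    ultimately show ?thesis using f g NG by (auto simp: W_def \<rho>_vec \<rho>_zero)
  qed

  obtain m :: nat and u h where basis: "\<forall>i<m. u i \<in> carrier_vec n" "\<forall>i<m. h i \<in> W"
    "\<forall>i<m. \<forall>j<m. h i (u j) = (if i = j then 1 else 0)"
    "\<forall>f\<in>W. \<forall>w\<in>carrier_vec n. f w = (\<Sum>i<m. f (u i) * h i w)"
    by (rule poly_functions_upto_interpolation[OF W_poly W_lin]) (assumption, rule that)
  have u: "u i \<in> carrier_vec n" and h: "h i \<in> W" if "i < m" for i
    using basis(1,2) that by blast+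
  have dual: "h i (u j) = (if i = j then 1 else 0)" if "i < m" "j < m" for i j
    using basis(3) that by blast
  have expand: "f w = (\<Sum>i<m. f (u i) * h i w)" if "f \<in> W" "w \<in> carrier_vec n" for f w
    using basis(4) that by blast
  define \<phi> where "\<phi> = (\<lambda>w. vec m (\<lambda>i. h i w))"
  define \<sigma>\<^sub>0 where "\<sigma>\<^sub>0 = (\<lambda>g. mat m m (\<lambda>(i, j). h i (\<rho> g *\<^sub>v u j)))"
  define \<sigma> where "\<sigma> = (\<lambda>K. \<sigma>\<^sub>0 (SOME g. g \<in> K))"
  have h_translate: "h i (\<rho> g *\<^sub>v w) = (\<Sum>j<m. h i (\<rho> g *\<^sub>v u j) * h j w)"
    if "i < m" "g \<in> carrier G" "w \<in> carrier_vec n" for i g w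
    using expand[OF W_translate[OF h[OF that(1)] that(2)] that(3)] that(3) u by simp
  have equivariant: "\<phi> (\<rho> g *\<^sub>v w) = \<sigma>\<^sub>0 g *\<^sub>v \<phi> w" if "g \<in> carrier G" "w \<in> carrier_vec n" for g w
    using h_translate[OF _ that]
    by (intro eq_vecI) (auto simp: \<phi>_def \<sigma>\<^sub>0_def scalar_prod_def atLeast0LessThan)
  have \<sigma>: "\<sigma> (N #> g) = \<sigma>\<^sub>0 g" if g: "g \<in> carrier G" for g
  proof -
    have "g \<in> N #> g" using g subgroup_identity_component by (rule rcos_self)
    then have "(SOME k. k \<in> N #> g) \<in> N #> g" by (rule someI)
    then obtain x where x: "x \<in> N" "(SOME k. k \<in> N #> g) = x \<otimes> g" by (auto simp: r_coset_def)
    have "h i (\<rho> (x \<otimes> g) *\<^sub>v u j) = h i (\<rho> g *\<^sub>v u j)" if "i < m" "j < m" for i j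
      using that x g u NG by (simp add: \<rho>_mult W_inv[OF h] \<rho>_vec)
    then show ?thesis by (auto simp: \<sigma>_def x(2) \<sigma>\<^sub>0_def)
  qed
  have rep_Q: "rational_rep Q m \<sigma>"
    unfolding rational_rep_def
  proof (intro conjI allI impI ballI)
    show "\<sigma> \<in> carrier Q \<rightarrow> carrier_mat m m" by (auto simp: \<sigma>_def \<sigma>\<^sub>0_def)
    have "\<sigma> \<one>\<^bsub>Q\<^esub> = \<sigma>\<^sub>0 \<one>"
      using \<sigma>[of \<one>] identity_component_subset by (simp add: coset_mult_one)
    also have "\<dots> = 1\<^sub>m m" using u dual by (intro eq_matI) (auto simp: \<sigma>\<^sub>0_def \<rho>_one)
    finally show "\<sigma> \<one>\<^bsub>Q\<^esub> = 1\<^sub>m m" .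
  next
    fix K L assume "K \<in> carrier Q" "L \<in> carrier Q"
    then obtain g k where g: "g \<in> carrier G" "K = N #> g" and k: "k \<in> carrier G" "L = N #> k"
      unfolding carrier_Q by blast
    have "\<sigma>\<^sub>0 (g \<otimes> k) = \<sigma>\<^sub>0 g * \<sigma>\<^sub>0 k"
    proof (rule eq_matI)
      fix i j assume ij: "i < dim_row (\<sigma>\<^sub>0 g * \<sigma>\<^sub>0 k)" "j < dim_col (\<sigma>\<^sub>0 g * \<sigma>\<^sub>0 k)"
      then have "h i (\<rho> g *\<^sub>v (\<rho> k *\<^sub>v u j)) = (\<Sum>l<m. h i (\<rho> g *\<^sub>v u l) * h l (\<rho> k *\<^sub>v u j))"
        using g k u \<rho>_vec by (intro h_translate) (auto simp: \<sigma>\<^sub>0_def)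
      then show "\<sigma>\<^sub>0 (g \<otimes> k) $$ (i, j) = (\<sigma>\<^sub>0 g * \<sigma>\<^sub>0 k) $$ (i, j)"
        using ij g k u by (simp add: \<sigma>\<^sub>0_def \<rho>_mult scalar_prod_def atLeast0LessThan)
    qed (auto simp: \<sigma>\<^sub>0_def)
    then show "\<sigma> (K \<otimes>\<^bsub>Q\<^esub> L) = \<sigma> K * \<sigma> L"
      using g k by (simp only: mult_Q \<sigma> m_closed)
  next
    fix i j assume ij: "i < m" "j < m"
    have "(\<lambda>x\<in>carrier G. (\<lambda>K\<in>carrier Q. \<sigma> K $$ (i, j)) (N #> x)) =
        (\<lambda>x\<in>carrier G. h i (vec n (\<lambda>k. \<Sum>l<n. u j $ l * \<rho> x $$ (k, l))))"
    proof (intro restrict_ext)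
      fix x assume x: "x \<in> carrier G"
      have "\<rho> x *\<^sub>v u j = vec n (\<lambda>k. \<Sum>l<n. u j $ l * \<rho> x $$ (k, l))"
        using mult_mat_vec_eq[OF \<rho>[OF x] u[OF ij(2)]] by (simp add: mult.commute)
      moreover have "N #> x \<in> carrier Q" using x unfolding carrier_Q by blast
      ultimately show "(\<lambda>K\<in>carrier Q. \<sigma> K $$ (i, j)) (N #> x) =
          h i (vec n (\<lambda>k. \<Sum>l<n. u j $ l * \<rho> x $$ (k, l)))"
        using x ij by (simp only: restrict_apply' \<sigma>) (simp add: \<sigma>\<^sub>0_def)
    qed
    moreover have "(\<lambda>x\<in>carrier G. h i (vec n (\<lambda>k. \<Sum>l<n. u j $ l * \<rho> x $$ (k, l)))) \<in> regular_functions G"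
    proof (rule regular_poly)
      show "h i \<in> poly_functions n" using h[OF ij(1)] by (auto simp: W_def poly_functions_def)
      show "(\<lambda>x\<in>carrier G. \<Sum>l<n. u j $ l * \<rho> x $$ (k, l)) \<in> regular_functions G" if "k < n" for k
        using rep that by (intro regular_linear) (auto simp: rational_rep_def)
    qed
    ultimately show "(\<lambda>K\<in>carrier Q. \<sigma> K $$ (i, j)) \<in> regular_functions Q"
      by simp
  qed

  obtain f where f: "f \<in> W" "f v \<noteq> 0"
  proof -
    obtain f\<^sub>0 where f\<^sub>0: "f\<^sub>0 \<in> invariants G n \<rho>" "f\<^sub>0 (0\<^sub>v n) = 0" "f\<^sub>0 v \<noteq> 0"
      using v v_vec by (auto simp: nullcone_def plus_part_def constant_term_def)
    then have "f\<^sub>0 \<in> invariants (identity_component G) n \<rho>"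
      using NG unfolding invariants_iff[OF is_group] invariants_iff[OF group_identity_component] by simp
    then have "v \<in> fixed_points (identity_component G) n \<rho> - nullcone (identity_component G) n \<rho>"
      using v f\<^sub>0 NG by (auto simp: fixed_points_def nullcone_def plus_part_def constant_term_def)
    moreover have "delta_set (identity_component G) n \<rho> (invariants_upto (identity_component G) n \<rho> d)"
      using d rational_rep_identity_component[OF rep] unfolding delta_le_iff by blast
    ultimately obtain f where "f \<in> invariants (identity_component G) n \<rho>" "f \<in> poly_functions_upto n d"
      "f (0\<^sub>v n) = 0" "f v \<noteq> 0"
      unfolding delta_set_invariants_upto_iff by blast
    then show ?thesis
      by (intro that[of f]) (simp_all add: W_def invariants_iff[OF group_identity_component])
  qed
  have "\<phi> v \<noteq> 0\<^sub>v m"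
  proof
    assume zero: "\<phi> v = 0\<^sub>v m"
    have "h i v = 0" if "i < m" for i
      using arg_cong[OF zero, of "\<lambda>w. w $ i"] that by (simp add: \<phi>_def)
    then show False using expand[OF f(1) v_vec] f(2) by simp
  qed
  moreover have "\<phi> v \<in> fixed_points Q m \<sigma>"
    unfolding fixed_points_def
  proof (intro CollectI conjI ballI)
    show "\<phi> v \<in> carrier_vec m" by (simp add: \<phi>_def)
    fix K assume "K \<in> carrier Q"
    then obtain g where g: "g \<in> carrier G" "K = N #> g" unfolding carrier_Q by blast
    then show "\<sigma> K *\<^sub>v \<phi> v = \<phi> v"
      using equivariant[OF g(1) v_vec] v by (simp add: \<sigma> fixed_points_def)
  qed
  moreover have "\<phi> v \<notin> nullcone Q m \<sigma>"
    using finite_group_separates[OF group_Q finite_carrier_Q rep_Q calculation(2,1)]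
    by (auto simp: nullcone_def plus_part_def constant_term_def)
  moreover have "delta_set Q m \<sigma> (invariants_upto Q m \<sigma> e)"
    using e rep_Q unfolding delta_le_iff by blast
  ultimately obtain p where p: "p \<in> invariants Q m \<sigma>" "p \<in> poly_functions_upto m e"
    "p (0\<^sub>v m) = 0" "p (\<phi> v) \<noteq> 0"
    unfolding delta_set_invariants_upto_iff by blast
  define F where "F = (\<lambda>w\<in>carrier_vec n. p (\<phi> w))"
  have "restrict (h i) (carrier_vec n) \<in> poly_functions_upto n d" if "i < m" for i
    using subsetD[OF W_poly h[OF that]] by simp
  then have F_poly: "F \<in> poly_functions_upto n (e * d)"
    unfolding F_def \<phi>_def by (intro poly_functions_upto_compose p(2))
  have "p (\<phi> (\<rho> g *\<^sub>v w)) = p (\<phi> w)" if g: "g \<in> carrier G" and w: "w \<in> carrier_vec n" for g w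
  proof -
    have "N #> g \<in> carrier Q" using g unfolding carrier_Q by blast
    moreover have "\<phi> w \<in> carrier_vec m" by (simp add: \<phi>_def)
    ultimately have "p (\<sigma> (N #> g) *\<^sub>v \<phi> w) = p (\<phi> w)"
      using p(1) unfolding invariants_iff[OF group_Q] by blast
    then show ?thesis using equivariant[OF g w] g by (simp add: \<sigma>)
  qed
  then have "F \<in> invariants G n \<rho>"
    using F_poly unfolding invariants_iff[OF is_group] by (auto simp: F_def \<rho>_vec poly_functions_def)
  moreover have "\<phi> (0\<^sub>v n) = 0\<^sub>v m"
    using h W_zero by (intro eq_vecI) (auto simp: \<phi>_def)
  then have "F (0\<^sub>v n) = 0" using p(3) by (simp add: F_def)
  moreover have "F v \<noteq> 0" using p(4) v_vec by (simp add: F_def)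
  ultimately show "\<exists>f\<in>invariants G n \<rho> \<inter> poly_functions_upto n (e * d). f (0\<^sub>v n) = 0 \<and> f v \<noteq> 0"
    using F_poly by blast
qed

end

theorem corollary2p4:
  fixes G :: "('a, 'k::alg_closed_field) algebraic_group"
  assumes "linear_algebraic_group G"
  shows "delta G \<le> delta (quotient_group G (identity_component_set G)) * delta (identity_component G)
    \<and> (delta (identity_component G) < \<infinity> \<longrightarrow> delta G < \<infinity>)"
proof -
  interpret linear_algebraic_group G by fact
  have "delta Q \<le> enat (card (carrier Q))"
    by (rule delta_finite_group[OF group_Q finite_carrier_Q])
  then obtain e where e: "delta Q = enat e" by (cases "delta Q") auto
  have "e \<noteq> 0" using delta_nonzero[OF regular_const_Q group_Q] e by (auto simp: zero_enat_def)
  show ?thesis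
  proof (cases "delta (identity_component G)")
    case infinity
    then show ?thesis using e \<open>e \<noteq> 0\<close> by (simp add: zero_enat_def)
  next
    case (enat d)
    have "delta G \<le> enat (e * d)"
      unfolding delta_le_iff using delta_set_product[of _ _ d e] enat e by simp
    then show ?thesis using enat e by (cases "delta G") (auto simp: times_enat_simps)
  qed
qed

end
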